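(* Let $\mathcal{H}$ be a separable real Hilbert space, let $A\colon \mathcal{H}\rightrightarrows\mathcal{H}$ be maximally monotone, and let $B\colon \mathcal{H}\to\mathcal{H}$ be monotone with $B=\frac{1}{n}\sum_{i=1}^nB_i$ for $L$-Lipschitz continuous operators $B_i\colon\mathcal{H}\to\mathcal{H}$, $i=1,\dots,n$. Suppose that $(A+B)^{-1}(0)\neq\varnothing$ and that $\lambda\in\left(0,\frac{1}{2L}\right)$. Given $x_0,x_{-1}\in\mathcal{H}$, define the sequence $(x_k)$ by: for each $k\in\mathbb{N}$, choose $i_k$ uniformly at random from $\{1,\dots,n\}$ (independently of the past) and set $$x_{k+1} = J_{\lambda A}\bigl( x_k-\lambda B(x_k) - \lambda( B_{i_k}(x_k) - B_{i_k}(x_{k-1})) \bigr).$$ Then $(x_k)$ converges weakly almost surely to a $(A+B)^{-1}(0)$-valued random variable.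
   Context: $J_{\lambda A}:=(I+\lambda A)^{-1}$ is the resolvent of $\lambda A$. *)

theory Defs
  imports "HOL-Probability.Probability"
begin

definition monotone_op :: "('a::real_inner \<Rightarrow> 'a set) \<Rightarrow> bool" where
  "monotone_op A \<longleftrightarrow>
     (\<forall>x y u v. u \<in> A x \<longrightarrow> v \<in> A y \<longrightarrow> inner (x - y) (u - v) \<ge> 0)"

definition maximal_monotone :: "('a::real_inner \<Rightarrow> 'a set) \<Rightarrow> bool" where
  "maximal_monotone A \<longleftrightarrow> monotone_op A \<and>
     (\<forall>A'. monotone_op A' \<and> (\<forall>x. A x \<subseteq> A' x) \<longrightarrow> A' = A)"

definition monotone_map :: "('a::real_inner \<Rightarrow> 'a) \<Rightarrow> bool" where
  "monotone_map B \<longleftrightarrow> (\<forall>x y. inner (x - y) (B x - B y) \<ge> 0)"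

text \<open>Resolvent J_{lam A} = (I + lam A)^{-1}: J z is the (unique, for maximally
  monotone A and lam > 0) point x with z \<in> x + lam A x.\<close>
definition resolvent :: "real \<Rightarrow> ('a::real_inner \<Rightarrow> 'a set) \<Rightarrow> 'a \<Rightarrow> 'a" where
  "resolvent lam A z = (THE x. \<exists>u \<in> A x. z = x + lam *\<^sub>R u)"

definition zeros_sum :: "('a::real_inner \<Rightarrow> 'a set) \<Rightarrow> ('a \<Rightarrow> 'a) \<Rightarrow> 'a set" where
  "zeros_sum A B = {x. \<exists>u \<in> A x. u + B x = 0}"

definition weakly_tendsto :: "(nat \<Rightarrow> 'a::real_inner) \<Rightarrow> 'a \<Rightarrow> bool" where
  "weakly_tendsto x z \<longleftrightarrow> (\<forall>y. (\<lambda>k. inner (x k) y) \<longlonglongrightarrow> inner z y)"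

text \<open>The iteration: fbf_iter ... k = (x_k, x_{k-1}), with idx k = i_k.\<close>
fun fbf_iter :: "('a::real_vector \<Rightarrow> 'a) \<Rightarrow> ('a \<Rightarrow> 'a) \<Rightarrow> (nat \<Rightarrow> 'a \<Rightarrow> 'a) \<Rightarrow> real
     \<Rightarrow> 'a \<Rightarrow> 'a \<Rightarrow> (nat \<Rightarrow> nat) \<Rightarrow> nat \<Rightarrow> 'a \<times> 'a" where
  "fbf_iter J B Bi lam x0 xm1 idx 0 = (x0, xm1)"
| "fbf_iter J B Bi lam x0 xm1 idx (Suc k) =
     (let (x, xp) = fbf_iter J B Bi lam x0 xm1 idx k
      in (J (x - lam *\<^sub>R B x - lam *\<^sub>R (Bi (idx k) x - Bi (idx k) xp)), x))"

end

theory Submission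
  imports Defs "HOL-Library.Diagonal_Subsequence"
begin

text \<open>With \<open>i\<close> uniform, the quantity
  \<open>V = |x_k - z|^2 - 2 lam <x_k - z, B x_k - B x_{k-1}> + |x_k - x_{k-1}|^2 / 2\<close>
  is, for every zero \<open>z\<close>, a nonnegative supermartingale whose expected decrease is at least
  \<open>(1/2 - lam L) |x_k - x_{k-1}|^2\<close>. Hence almost surely \<open>x_k - x_{k-1}\<close> tends to 0 and, for all
  \<open>z\<close> in a countable dense set of zeros and so for all zeros, \<open>|x_k - z|\<close> converges. Weak cluster
  points are zeros, so Opial's lemma gives weak convergence. As the indices take finitely many
  values, the iterates are functions of the finite word of past indices, and conditional
  expectations are averages over the next letter.\<close>

section \<open>Minimisation, the Riesz representation and Minty's theorem\<close>

text \<open>A weight c in place of 1/2 in \<open>V\<close> would have to satisfy two demands. One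
  step yields |x_{k+1} - x_k|^2 with coefficient 1; Young's inequality takes lam L of it and charges
  lam L |x_k - x_{k-1}|^2 to the preceding step. So the new term of \<open>V\<close> needs c <= 1 -
  lam L, and the old one must cover lam L with something to spare, lam L < c. The only value that
  serves all lam L < 1/2 is c = 1/2, and the slack 1/2 - lam L is the expected decrease. The bound
  is kept in the form \<open>lam * (2 * L) < 1\<close>, which admits L = 0. The random difference is
  paired with x_{k+1} - z, which depends on the drawn index. It is split at x_k: the part paired
  with x_k - z averages exactly to the cross term of \<open>V\<close>, and only the part along
  x_{k+1} - x_k is estimated. Since \<open>resolvent\<close> is a definite description, nothing is
  known about the iterates until I + lam A is shown to be onto, which is Minty's theorem.\<close>

lemma norm_midpoint_sq:
  fixes x y :: "'a::real_inner"
  shows "(norm ((1/2) *\<^sub>R (x + y)))\<^sup>2 = ((norm x)\<^sup>2 + (norm y)\<^sup>2) / 2 - (norm (x - y))\<^sup>2 / 4"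
  by (simp add: power2_norm_eq_inner inner_add inner_diff inner_commute field_simps)

text \<open>The uniform convexity gap in \<open>mid\<close> makes every minimising sequence Cauchy.
  The hypothesis \<open>lsc\<close> also returns membership of the limit, because in the application
  to the Fitzpatrick function the domain \<open>S\<close> is not known to be closed.\<close>

lemma midpoint_convex_minimizer:
  fixes S :: "'a::{real_inner,complete_space} set" and g :: "'a \<Rightarrow> real"
  assumes ne: "S \<noteq> {}" and lb: "\<And>x. x \<in> S \<Longrightarrow> m0 \<le> g x" and c: "c > 0"
    and mid_in: "\<And>x y. x \<in> S \<Longrightarrow> y \<in> S \<Longrightarrow> (1/2) *\<^sub>R (x + y) \<in> S"
    and mid: "\<And>x y. x \<in> S \<Longrightarrow> y \<in> S \<Longrightarrow>
      g ((1/2) *\<^sub>R (x + y)) \<le> (g x + g y) / 2 - c * (norm (x - y))\<^sup>2"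
    and lsc: "\<And>X z l. (\<And>k::nat. X k \<in> S) \<Longrightarrow> X \<longlonglongrightarrow> z \<Longrightarrow> (\<lambda>k. g (X k)) \<longlonglongrightarrow> l
      \<Longrightarrow> z \<in> S \<and> g z \<le> l"
  shows "\<exists>z\<in>S. \<forall>x\<in>S. g z \<le> g x"
proof -
  define m where "m = Inf (g ` S)"
  have bdd: "bdd_below (g ` S)" using lb by (auto intro!: bdd_belowI[of _ m0])
  have m_le: "m \<le> g x" if "x \<in> S" for x
    unfolding m_def using that bdd by (auto intro: cInf_lower)
  have "\<exists>x\<in>S. g x < m + 1 / real (Suc k)" for k
    using cInf_lessD[of "g ` S" "m + 1 / real (Suc k)"] ne unfolding m_def by fastforce
  then obtain X where X: "\<And>k. X k \<in> S" "\<And>k. g (X k) < m + 1 / real (Suc k)" by metis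
  have lim: "(\<lambda>k. g (X k)) \<longlonglongrightarrow> m"
  proof (rule tendsto_sandwich)
    show "\<forall>\<^sub>F k in sequentially. m \<le> g (X k)" using m_le X(1) by auto
    show "\<forall>\<^sub>F k in sequentially. g (X k) \<le> m + 1 / real (Suc k)"
      by (intro always_eventually allI less_imp_le X(2))
    show "(\<lambda>k. m + 1 / real (Suc k)) \<longlonglongrightarrow> m"
      using tendsto_add[OF tendsto_const LIMSEQ_inverse_real_of_nat, of m]
      by (simp add: inverse_eq_divide)
  qed simp
  have "Cauchy X"
  proof (rule metric_CauchyI)
    fix e :: real assume e: "e > 0"
    obtain N where N: "1 / real (Suc N) < c * e\<^sup>2"
      using reals_Archimedean[of "c * e\<^sup>2"] e c by (auto simp: inverse_eq_divide)
    have "dist (X i) (X j) < e" if ij: "i \<ge> N" "j \<ge> N" for i j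
    proof -
      have gb: "g (X k) < m + 1 / real (Suc N)" if "k \<ge> N" for k
      proof -
        have "1 / real (Suc k) \<le> 1 / real (Suc N)" using that by (intro divide_left_mono) auto
        then show ?thesis using X(2)[of k] by linarith
      qed
      have "m \<le> (g (X i) + g (X j)) / 2 - c * (norm (X i - X j))\<^sup>2"
        using mid[OF X(1) X(1), of i j] m_le[OF mid_in[OF X(1) X(1), of i j]] by linarith
      moreover have "q < r" if "m \<le> (a + b) / 2 - q" "a < m + d" "b < m + d" "d < r"
        for a b q d r :: real using that by argo
      ultimately have "c * (norm (X i - X j))\<^sup>2 < c * e\<^sup>2"
        using gb[OF ij(1)] gb[OF ij(2)] N by blast
      then have "(norm (X i - X j))\<^sup>2 < e\<^sup>2" using c by simp
      then show ?thesis using e by (simp add: dist_norm power_less_imp_less_base)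
    qed
    then show "\<exists>N. \<forall>i\<ge>N. \<forall>j\<ge>N. dist (X i) (X j) < e" by blast
  qed
  then obtain z where z: "X \<longlonglongrightarrow> z" using Cauchy_convergent convergent_def by blast
  show ?thesis using lsc[OF X(1) z lim] m_le by (meson order_trans)
qed

text \<open>Divide by t and let t decrease to 0. This turns minimality along a segment into a
  first-order condition.\<close>

lemma first_order_nonneg:
  fixes p q :: real
  assumes "\<And>t. 0 < t \<Longrightarrow> t < 1 \<Longrightarrow> 0 \<le> t * p + t\<^sup>2 * q"
  shows "0 \<le> p"
proof -
  have "((\<lambda>t. p + t * q) \<longlongrightarrow> p + 0 * q) (at_right 0)" by (intro tendsto_intros)
  moreover have "\<forall>\<^sub>F t in at_right (0::real). 0 \<le> p + t * q"
  proof (rule eventually_at_rightI)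
    fix t :: real assume t: "t \<in> {0<..<1}"
    then have "0 \<le> t * (p + t * q)" using assms[of t] by (simp add: algebra_simps power2_eq_square)
    then show "0 \<le> p + t * q" using t by (simp add: zero_le_mult_iff)
  qed simp
  ultimately have "0 \<le> p + 0 * q" by (rule tendsto_lowerbound) simp
  then show ?thesis by simp
qed

text \<open>If z represents f, then |y|^2 - 2 f y = |y - z|^2 - |z|^2; so the representing vector is
  sought as the minimiser of the left-hand side.\<close>

lemma riesz_representation:
  fixes f :: "'a::{real_inner,complete_space} \<Rightarrow> real"
  assumes f: "bounded_linear f"
  shows "\<exists>z. \<forall>y. f y = inner z y"
proof -
  interpret f: bounded_linear f by (rule f)
  obtain K where K: "\<And>y. norm (f y) \<le> norm y * K" using f.bounded by blast
  define g where "g y = (norm y)\<^sup>2 - 2 * f y" for y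
  have "\<exists>z\<in>UNIV. \<forall>x\<in>UNIV. g z \<le> g x"
  \<comment> \<open>The gap 1/4 is exact by the parallelogram identity, as \<open>f\<close> is
    linear; the lower bound -K^2 comes from completing the square in the norm.\<close>
  proof (rule midpoint_convex_minimizer[where c = "1/4" and ?m0.0 = "- K\<^sup>2"])
    fix x show "- K\<^sup>2 \<le> g x"
    proof -
      have "f x \<le> norm x * K" using K[of x] by simp
      moreover have "0 \<le> (norm x - K)\<^sup>2" by simp
      ultimately show ?thesis unfolding g_def by (simp add: power2_diff)
    qed
  next
    fix x y show "g ((1/2) *\<^sub>R (x + y)) \<le> (g x + g y) / 2 - 1/4 * (norm (x - y))\<^sup>2"
      unfolding g_def norm_midpoint_sq by (simp add: f.scaleR f.add field_simps)
  next
    fix X z l assume X: "X \<longlonglongrightarrow> z" and l: "(\<lambda>k. g (X k)) \<longlonglongrightarrow> l"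
    have "(\<lambda>k. g (X k)) \<longlonglongrightarrow> g z" unfolding g_def by (intro tendsto_intros f.tendsto X)
    then show "z \<in> UNIV \<and> g z \<le> l" using LIMSEQ_unique[OF l] by auto
  qed auto
  then obtain z where z: "\<And>x. g z \<le> g x" by auto
  have ge: "f y \<le> inner z y" for y
  proof -
    have "0 \<le> 2 * (inner z y - f y)"
    proof (rule first_order_nonneg)
      fix t :: real
      show "0 \<le> t * (2 * (inner z y - f y)) + t\<^sup>2 * (norm y)\<^sup>2"
        using z[of "z + t *\<^sub>R y"] unfolding g_def power2_norm_eq_inner
        by (simp add: inner_add f.add f.scaleR inner_commute power2_eq_square algebra_simps)
    qed
    then show ?thesis by simp
  qed
  have "f y = inner z y" for y using ge[of y] ge[of "- y"] f.neg[of y] by simp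
  then show ?thesis by blast
qed

section \<open>Maximal monotone operators and surjectivity of I + lam A\<close>

lemma maximal_monotoneD:
  assumes "maximal_monotone A" "u \<in> A x" "v \<in> A y"
  shows "0 \<le> inner (x - y) (u - v)"
  using assms unfolding maximal_monotone_def monotone_op_def by blast

text \<open>Adding the pair (x, u) to the graph keeps it monotone, so maximality says that it was
  there already.\<close>

lemma maximal_monotone_memberI:
  assumes A: "maximal_monotone A" and rel: "\<And>a b. b \<in> A a \<Longrightarrow> 0 \<le> inner (x - a) (u - b)"
  shows "u \<in> A x"
proof -
  define A' where "A' = A(x := insert u (A x))"
  have "monotone_op A'"
    unfolding monotone_op_def
  proof (intro allI impI)
    fix y z v w assume "v \<in> A' y" "w \<in> A' z"
    then have v: "v \<in> A y \<or> (v = u \<and> y = x)" and w: "w \<in> A z \<or> (w = u \<and> z = x)"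
      unfolding A'_def by (auto split: if_splits)
    have rel': "0 \<le> inner (a - x) (b - u)" if "b \<in> A a" for a b
      using rel[OF that] by (simp add: inner_diff algebra_simps)
    show "0 \<le> inner (y - z) (v - w)"
      using v w maximal_monotoneD[OF A] rel rel' by auto
  qed
  moreover have "\<forall>y. A y \<subseteq> A' y" unfolding A'_def by auto
  ultimately have "A' = A" using A unfolding maximal_monotone_def by blast
  then have "A' x = A x" by simp
  then show ?thesis unfolding A'_def by auto
qed

text \<open>Minimise the Fitzpatrick function plus half the squared norm: the reflection
  \<open>(-u0, -x0)\<close> of a minimiser \<open>(x0, u0)\<close> is monotonically related to \<open>G\<close>, hence lies in \<open>G\<close>,
  and testing the optimality condition at that point forces \<open>x0 + u0 = 0\<close>.\<close>
lemma maximal_monotone_graph_antidiagonal: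
  fixes G :: "('a::{real_inner,complete_space} \<times> 'a) set"
  assumes mon: "\<And>a b c d. (a, b) \<in> G \<Longrightarrow> (c, d) \<in> G \<Longrightarrow> 0 \<le> inner (a - c) (b - d)"
    and max: "\<And>x u. (\<And>a b. (a, b) \<in> G \<Longrightarrow> 0 \<le> inner (x - a) (u - b)) \<Longrightarrow> (x, u) \<in> G"
  shows "\<exists>a. (a, - a) \<in> G"
proof -
  define h where "h p z = inner (fst z) (snd p) + inner (fst p) (snd z) - inner (fst p) (snd p)"
    for p z :: "'a \<times> 'a"
  \<comment> \<open>The supremum \<open>F\<close> below is real-valued, so the effective domain of
    the Fitzpatrick function has to be carried along as a set.\<close>
  define S where "S = {z. bdd_above ((\<lambda>p. h p z) ` G)}"
  define F where "F z = (SUP p\<in>G. h p z)" for z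
  define g where "g z = F z + (norm z)\<^sup>2 / 2" for z
  have Gne: "G \<noteq> {}" using max by blast
  have h_le: "h p z \<le> F z" if "p \<in> G" "z \<in> S" for p z
    unfolding F_def using that by (auto simp: S_def intro: cSUP_upper)
  have F_le: "z \<in> S \<and> F z \<le> C" if "\<And>p. p \<in> G \<Longrightarrow> h p z \<le> C" for z C
    using that Gne unfolding F_def S_def by (auto intro!: cSUP_least bdd_aboveI2[of _ _ C])
  have h_aff: "h p ((1 - t) *\<^sub>R z + t *\<^sub>R y) = (1 - t) * h p z + t * h p y" for p z y t
    unfolding h_def by (simp add: inner_add algebra_simps)
  have conv: "(1 - t) *\<^sub>R z + t *\<^sub>R y \<in> S \<and>
      F ((1 - t) *\<^sub>R z + t *\<^sub>R y) \<le> (1 - t) * F z + t * F y"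
    if "z \<in> S" "y \<in> S" "0 \<le> t" "t \<le> 1" for z y t
    by (rule F_le) (unfold h_aff, intro add_mono mult_left_mono h_le, use that in auto)
  have G_F: "z \<in> S \<and> F z \<le> inner (fst z) (snd z)" if "z \<in> G" for z
  proof (rule F_le)
    fix p assume "p \<in> G"
    then show "h p z \<le> inner (fst z) (snd z)"
      using mon[of "fst z" "snd z" "fst p" "snd p"] that unfolding h_def
      by (simp add: inner_diff algebra_simps)
  qed
  \<comment> \<open>With \<open>G_F\<close>: the Fitzpatrick function dominates the duality pairing
    and equals it on \<open>G\<close>. Off \<open>G\<close>, maximality supplies a point of negative
    pairing.\<close>
  have F_ge: "inner (fst z) (snd z) \<le> F z" if "z \<in> S" for z
  proof (cases "z \<in> G")
    case True
    then show ?thesis using h_le[OF True that] unfolding h_def by simp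
  next
    case False
    then obtain a b where ab: "(a, b) \<in> G" "inner (fst z - a) (snd z - b) < 0"
      using max[of "fst z" "snd z"] by force
    then show ?thesis using h_le[OF ab(1) that] unfolding h_def
      by (simp add: inner_diff algebra_simps)
  qed
  have normsq: "(norm z)\<^sup>2 = inner (fst z) (fst z) + inner (snd z) (snd z)" for z :: "'a \<times> 'a"
    by (simp add: power2_norm_eq_inner inner_prod_def)
  have sq_nonneg: "0 \<le> inner x x + 2 * inner x u + inner u u" for x u :: 'a
    using inner_ge_zero[of "x + u"] by (simp add: inner_add inner_commute algebra_simps)
  have g_nonneg: "0 \<le> g z" if "z \<in> S" for z
    using F_ge[OF that] sq_nonneg[of "fst z" "snd z"] unfolding g_def normsq by (simp add: field_simps)
  have "\<exists>z\<in>S. \<forall>x\<in>S. g z \<le> g x"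
  proof (rule midpoint_convex_minimizer[where c = "1/8" and ?m0.0 = 0])
    show "S \<noteq> {}" using Gne G_F by blast
  next
    fix x y assume xy: "x \<in> S" "y \<in> S"
    have eq: "(1/2) *\<^sub>R (x + y) = (1 - 1/2) *\<^sub>R x + (1/2) *\<^sub>R y" by (simp add: scaleR_add_right)
    show "(1/2) *\<^sub>R (x + y) \<in> S" unfolding eq using conv[OF xy, of "1/2"] by simp
    have "F ((1/2) *\<^sub>R (x + y)) \<le> (F x + F y) / 2" unfolding eq using conv[OF xy, of "1/2"] by simp
    then show "g ((1/2) *\<^sub>R (x + y)) \<le> (g x + g y) / 2 - 1/8 * (norm (x - y))\<^sup>2"
      unfolding g_def norm_midpoint_sq by (simp add: field_simps)
  next
    fix X z l assume X: "\<And>k::nat. X k \<in> S" "X \<longlonglongrightarrow> z" "(\<lambda>k. g (X k)) \<longlonglongrightarrow> l"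
    have "(\<lambda>k. g (X k) - (norm (X k))\<^sup>2 / 2) \<longlonglongrightarrow> l - (norm z)\<^sup>2 / 2"
      by (intro tendsto_intros X) simp
    then have FX: "(\<lambda>k. F (X k)) \<longlonglongrightarrow> l - (norm z)\<^sup>2 / 2" unfolding g_def by simp
    have "h p z \<le> l - (norm z)\<^sup>2 / 2" if "p \<in> G" for p
    proof (rule LIMSEQ_le[OF _ FX])
      show "(\<lambda>k. h p (X k)) \<longlonglongrightarrow> h p z" unfolding h_def by (intro tendsto_intros X)
      show "\<exists>N. \<forall>n\<ge>N. h p (X n) \<le> F (X n)" using h_le[OF that X(1)] by auto
    qed
    then show "z \<in> S \<and> g z \<le> l" using F_le[of z "l - (norm z)\<^sup>2 / 2"] unfolding g_def by force
  qed (use g_nonneg in auto)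
  then obtain z0 where z0: "z0 \<in> S" and zmin: "\<And>x. x \<in> S \<Longrightarrow> g z0 \<le> g x" by blast
  obtain x0 u0 where z0_eq: "z0 = (x0, u0)" by fastforce
  \<comment> \<open>Optimality of \<open>z0\<close>: its negative is a subgradient of
    \<open>F\<close> at \<open>z0\<close>.\<close>
  have grad: "F z0 - inner z0 (z - z0) \<le> F z" if z: "z \<in> S" for z
  proof -
    have "0 \<le> F z - F z0 + inner z0 (z - z0)"
    proof (rule first_order_nonneg)
      fix t :: real assume t: "0 < t" "t < 1"
      have eq: "(1 - t) *\<^sub>R z0 + t *\<^sub>R z = z0 + t *\<^sub>R (z - z0)" by (simp add: algebra_simps)
      have "g z0 \<le> (1 - t) * F z0 + t * F z + (norm (z0 + t *\<^sub>R (z - z0)))\<^sup>2 / 2"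
        using conv[OF z0 z, of t] zmin[of "(1 - t) *\<^sub>R z0 + t *\<^sub>R z"] t
        unfolding g_def eq by force
      moreover have "(norm (z0 + t *\<^sub>R (z - z0)))\<^sup>2
          = (norm z0)\<^sup>2 + 2 * t * inner z0 (z - z0) + t\<^sup>2 * (norm (z - z0))\<^sup>2"
        unfolding power2_norm_eq_inner by (simp add: inner_add inner_commute power2_eq_square algebra_simps)
      ultimately show "0 \<le> t * (F z - F z0 + inner z0 (z - z0)) + t\<^sup>2 * ((norm (z - z0))\<^sup>2 / 2)"
        unfolding g_def by (simp add: algebra_simps)
    qed
    then show ?thesis by simp
  qed
  \<comment> \<open>The subgradient inequality at a point of \<open>G\<close>, where
    \<open>F\<close> is at most the pairing; adding inner x0 u0 to both sides factors the right and
    completes the square on the left.\<close>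
  have key: "g z0 + inner (x0 + u0) (x0 + u0) / 2 \<le> inner (a + u0) (b + x0)" if "(a, b) \<in> G" for a b
  proof -
    have "F z0 - inner z0 ((a, b) - z0) \<le> inner a b" using G_F[OF that] grad[of "(a, b)"] by auto
    then show ?thesis unfolding g_def normsq z0_eq
      by (simp add: inner_add inner_diff inner_commute field_simps)
  qed
  have in_G: "(- u0, - x0) \<in> G"
  proof (rule max)
    fix a b assume "(a, b) \<in> G"
    moreover have "inner (- u0 - a) (- x0 - b) = inner (a + u0) (b + x0)"
      by (simp add: inner_add inner_diff algebra_simps)
    ultimately show "0 \<le> inner (- u0 - a) (- x0 - b)"
      using key[of a b] g_nonneg[OF z0] inner_ge_zero[of "x0 + u0"] by linarith
  qed
  have "inner (x0 + u0) (x0 + u0) \<le> 0" using key[OF in_G] g_nonneg[OF z0] by simp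
  then have "x0 + u0 = 0" using inner_gt_zero_iff[of "x0 + u0"] by linarith
  then have "- x0 = - (- u0)" by (metis add.inverse_inverse minus_unique)
  then show ?thesis using in_G by metis
qed

text \<open>\<open>G\<close> is the graph of lam A - z, again maximal monotone; a point (a, -a) on
  it says that z lies in a + lam A a.\<close>

lemma minty:
  fixes A :: "'a::{real_inner,complete_space} \<Rightarrow> 'a set"
  assumes A: "maximal_monotone A" and lam: "0 < lam"
  shows "\<exists>x. \<exists>u\<in>A x. z = x + lam *\<^sub>R u"
proof -
  define G where "G = {(x, lam *\<^sub>R u - z) | x u. u \<in> A x}"
  have "\<exists>a. (a, - a) \<in> G"
  proof (rule maximal_monotone_graph_antidiagonal)
    fix a b c d assume "(a, b) \<in> G" "(c, d) \<in> G"
    then obtain u v where uv: "u \<in> A a" "b = lam *\<^sub>R u - z" "v \<in> A c" "d = lam *\<^sub>R v - z"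
      unfolding G_def by auto
    have "b - d = lam *\<^sub>R (u - v)" using uv by (simp add: scaleR_diff_right)
    then show "0 \<le> inner (a - c) (b - d)" using maximal_monotoneD[OF A uv(1) uv(3)] lam by simp
  next
    fix x u assume rel: "\<And>a b. (a, b) \<in> G \<Longrightarrow> 0 \<le> inner (x - a) (u - b)"
    have "(1 / lam) *\<^sub>R (u + z) \<in> A x"
    proof (rule maximal_monotone_memberI[OF A])
      fix a b assume "b \<in> A a"
      then have "0 \<le> inner (x - a) (u - (lam *\<^sub>R b - z))" using rel unfolding G_def by auto
      moreover have "u - (lam *\<^sub>R b - z) = lam *\<^sub>R ((1 / lam) *\<^sub>R (u + z) - b)"
        using lam by (simp add: algebra_simps)
      ultimately show "0 \<le> inner (x - a) ((1 / lam) *\<^sub>R (u + z) - b)"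
        using lam by (simp add: zero_le_mult_iff)
    qed
    moreover have "u = lam *\<^sub>R ((1 / lam) *\<^sub>R (u + z)) - z" using lam by simp
    ultimately show "(x, u) \<in> G" unfolding G_def by blast
  qed
  then obtain a u where au: "u \<in> A a" "- a = lam *\<^sub>R u - z" unfolding G_def by auto
  have "z = lam *\<^sub>R u - (- a)" unfolding au(2) by simp
  then have "z = a + lam *\<^sub>R u" by simp
  then show ?thesis using au(1) by blast
qed

text \<open>Existence is Minty's theorem; uniqueness holds because I + lam A is strongly monotone.
  All later reasoning about the resolvent goes through this inclusion.\<close>

lemma resolvent_inclusion:
  fixes A :: "'a::{real_inner,complete_space} \<Rightarrow> 'a set"
  assumes A: "maximal_monotone A" and lam: "0 < lam"
  shows "\<exists>u\<in>A (resolvent lam A z). z = resolvent lam A z + lam *\<^sub>R u"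
  unfolding resolvent_def
proof (rule theI')
  show "\<exists>!x. \<exists>u\<in>A x. z = x + lam *\<^sub>R u"
  proof (rule ex_ex1I)
    show "\<exists>x. \<exists>u\<in>A x. z = x + lam *\<^sub>R u" by (rule minty[OF A lam])
    fix x y assume "\<exists>u\<in>A x. z = x + lam *\<^sub>R u" "\<exists>u\<in>A y. z = y + lam *\<^sub>R u"
    then obtain u v where uv: "u \<in> A x" "z = x + lam *\<^sub>R u" "v \<in> A y" "z = y + lam *\<^sub>R v" by blast
    then have "x - y = - lam *\<^sub>R (u - v)" by (simp add: algebra_simps)
    then have "inner (x - y) (x - y) = - lam * inner (x - y) (u - v)" by simp
    then have "inner (x - y) (x - y) \<le> 0" using maximal_monotoneD[OF A uv(1) uv(3)] lam
      by (simp add: zero_le_mult_iff)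
    then show "x = y" by (metis eq_iff_diff_eq_0 inner_gt_zero_iff not_less)
  qed
qed

section \<open>Weak sequential compactness and Opial's lemma\<close>

text \<open>An e/4 argument shows the sequence to be Cauchy. It carries convergence from a dense set
  of test vectors, and later of zeros, to all of them.\<close>

lemma convergent_uniform_approx:
  fixes a :: "nat \<Rightarrow> 'a::{real_normed_vector,complete_space}"
  assumes approx: "\<And>e. 0 < e \<Longrightarrow> \<exists>c. convergent c \<and> (\<forall>k. dist (a k) (c k) \<le> e)"
  shows "convergent a"
  unfolding Cauchy_convergent_iff[symmetric]
proof (rule metric_CauchyI)
  fix e :: real assume e: "0 < e"
  obtain c where c: "convergent c" "\<And>k. dist (a k) (c k) \<le> e / 4" using approx[of "e / 4"] e by auto
  obtain N where N: "\<And>i j. i \<ge> N \<Longrightarrow> j \<ge> N \<Longrightarrow> dist (c i) (c j) < e / 4"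
    using metric_CauchyD[OF convergent_Cauchy[OF c(1)], of "e / 4"] e by auto
  have "dist (a i) (a j) < e" if ij: "i \<ge> N" "j \<ge> N" for i j
  proof -
    have "dist (a i) (a j) \<le> dist (a i) (c i) + dist (c i) (c j) + dist (a j) (c j)"
      by (metis add.commute add_left_mono dist_commute dist_triangle dist_triangle_le)
    then show ?thesis using c(2)[of i] c(2)[of j] N[OF ij] e by linarith
  qed
  then show "\<exists>N. \<forall>i\<ge>N. \<forall>j\<ge>N. dist (a i) (a j) < e" by blast
qed

text \<open>The pointwise limits form a bounded linear functional, and the weak limit is its Riesz
  representative.\<close>

lemma weakly_tendsto_exists:
  fixes x :: "nat \<Rightarrow> 'a::{real_inner,complete_space}"
  assumes conv: "\<And>y. convergent (\<lambda>k. inner (x k) y)" and bdd: "\<And>k. norm (x k) \<le> K"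
  shows "\<exists>p. weakly_tendsto x p"
proof -
  define f where "f y = lim (\<lambda>k. inner (x k) y)" for y
  have f: "(\<lambda>k. inner (x k) y) \<longlonglongrightarrow> f y" for y
    unfolding f_def using conv convergent_LIMSEQ_iff by blast
  have "bounded_linear f"
  proof (rule bounded_linear_intro)
    fix y z show "f (y + z) = f y + f z"
      using LIMSEQ_unique[OF f[of "y + z"]] tendsto_add[OF f[of y] f[of z]] by (simp add: inner_add)
  next
    fix c y show "f (c *\<^sub>R y) = c *\<^sub>R f y"
      using LIMSEQ_unique[OF f[of "c *\<^sub>R y"]] tendsto_mult[OF tendsto_const[of c] f[of y]] by simp
  next
    fix y
    have "norm (inner (x k) y) \<le> norm y * K" for k
      using Cauchy_Schwarz_ineq2[of "x k" y] mult_right_mono[OF bdd[of k], of "norm y"]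
      by (simp add: mult.commute)
    then show "norm (f y) \<le> norm y * K"
      by (intro tendsto_upperbound[OF tendsto_norm[OF f]]) auto
  qed
  then obtain p where "\<And>y. f y = inner p y" using riesz_representation by blast
  then show ?thesis using f unfolding weakly_tendsto_def by auto
qed

text \<open>Cantor's diagonal argument over a countable dense set of test vectors; boundedness then
  extends convergence to every test vector.\<close>

lemma bounded_weak_subsequence:
  fixes x :: "nat \<Rightarrow> 'a::{real_inner,complete_space}"
  assumes sep: "\<exists>D::'a set. countable D \<and> closure D = UNIV" and bdd: "\<And>k. norm (x k) \<le> K"
  shows "\<exists>r p. strict_mono (r :: nat \<Rightarrow> nat) \<and> weakly_tendsto (x \<circ> r) p"
proof -
  obtain D :: "'a set" where D: "countable D" "closure D = UNIV" using sep by blast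
  then have "D \<noteq> {}" by auto
  define d where "d = from_nat_into D"
  have dD: "range d = D" unfolding d_def using D \<open>D \<noteq> {}\<close> by (simp add: range_from_nat_into)
  have K: "0 \<le> K" using bdd[of 0] norm_ge_zero order_trans by blast
  interpret subseqs "\<lambda>m s. convergent (\<lambda>k. inner (x (s k)) (d m))"
  proof
    fix m and s :: "nat \<Rightarrow> nat"
    have "norm (inner (x (s k)) (d m)) \<le> K * norm (d m)" for k
      using Cauchy_Schwarz_ineq2[of "x (s k)" "d m"] mult_right_mono[OF bdd[of "s k"], of "norm (d m)"]
      by simp
    then have "bounded (range (\<lambda>k. inner (x (s k)) (d m)))" by (auto simp: bounded_iff)
    then obtain l r where "strict_mono (r::nat\<Rightarrow>nat)" "((\<lambda>k. inner (x (s k)) (d m)) \<circ> r) \<longlonglongrightarrow> l"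
      using bounded_imp_convergent_subsequence by blast
    then show "\<exists>r'. strict_mono (r'::nat\<Rightarrow>nat) \<and> convergent (\<lambda>k. inner (x ((s \<circ> r') k)) (d m))"
      by (auto simp: convergent_def o_def)
  qed
  \<comment> \<open>From index \<open>Suc m\<close> on, the diagonal sequence is a subsequence of
    the one chosen for \<open>d m\<close>.\<close>
  have cd: "convergent (\<lambda>k. inner (x (diagseq k)) (d m))" for m
  proof -
    have "convergent (\<lambda>k. inner (x ((diagseq \<circ> (+) (Suc m)) k)) (d m))"
    proof (rule diagseq_holds)
      fix r s :: "nat \<Rightarrow> nat" and n
      assume "strict_mono r" "convergent (\<lambda>k. inner (x (s k)) (d n))"
      then show "convergent (\<lambda>k. inner (x ((s \<circ> r) k)) (d n))"
        using convergent_subseq_convergent[of "\<lambda>k. inner (x (s k)) (d n)" r] by (simp add: o_def)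
    qed
    then have "convergent (\<lambda>k. inner (x (diagseq (k + Suc m))) (d m))" by (simp add: o_def add.commute)
    then show ?thesis using convergent_ignore_initial_segment by blast
  qed
  have "convergent (\<lambda>k. inner ((x \<circ> diagseq) k) y)" for y
  proof (rule convergent_uniform_approx)
    fix e :: real assume e: "0 < e"
    have "y \<in> closure D" using D by simp
    \<comment> \<open>The summand 1 in \<open>K + 1\<close> keeps the quotient meaningful when K =
      0.\<close>
    then obtain z where z: "z \<in> D" "dist z y < e / (K + 1)"
      using e K by (meson closure_approachable divide_pos_pos add_nonneg_pos zero_less_one)
    obtain m where m: "z = d m" using z dD by blast
    have "dist (inner (x j) y) (inner (x j) z) \<le> e" for j
    proof -
      have "dist (inner (x j) y) (inner (x j) z) = \<bar>inner (x j) (y - z)\<bar>"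
        by (simp add: dist_real_def inner_diff)
      also have "\<dots> \<le> norm (x j) * norm (y - z)" by (rule Cauchy_Schwarz_ineq2)
      also have "\<dots> \<le> (K + 1) * (e / (K + 1))"
        using z bdd[of j] K e by (intro mult_mono) (auto simp: dist_norm norm_minus_commute)
      finally show ?thesis using K by simp
    qed
    then show "\<exists>c. convergent c \<and> (\<forall>k. dist (inner ((x \<circ> diagseq) k) y) (c k) \<le> e)"
      using cd[of m] m by (intro exI[of _ "\<lambda>k. inner (x (diagseq k)) (d m)"]) auto
  qed
  then obtain p where "weakly_tendsto (x \<circ> diagseq) p"
    using weakly_tendsto_exists[of "x \<circ> diagseq" K] bdd by auto
  then show ?thesis using subseq_diagseq by meson
qed

text \<open>For p and q in \<open>Z\<close>, |x_k - q|^2 - |x_k - p|^2 is 2 <x_k, p - q> up to a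
  constant, so <x_k, p - q> converges along the full sequence. If p and q are both weak cluster
  points, its limit is <p, p - q> and also <q, p - q>, hence p = q.\<close>

lemma opial:
  fixes x :: "nat \<Rightarrow> 'a::{real_inner,complete_space}"
  assumes sep: "\<exists>D::'a set. countable D \<and> closure D = UNIV" and ne: "Z \<noteq> {}"
    and conv: "\<And>z. z \<in> Z \<Longrightarrow> convergent (\<lambda>k. norm (x k - z))"
    and cluster: "\<And>r p. strict_mono (r :: nat \<Rightarrow> nat) \<Longrightarrow> weakly_tendsto (x \<circ> r) p \<Longrightarrow> p \<in> Z"
  shows "\<exists>p\<in>Z. weakly_tendsto x p"
proof -
  obtain z where z: "z \<in> Z" using ne by blast
  obtain K where K: "\<And>k. norm (norm (x k - z)) \<le> K"
    using convergent_imp_Bseq[OF conv[OF z]] unfolding Bseq_def by blast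
  have bdd: "norm (x k) \<le> K + norm z" for k
    using K[of k] norm_triangle_sub[of "x k" z] by simp
  have sub: "\<exists>r p. strict_mono (r :: nat \<Rightarrow> nat) \<and> weakly_tendsto (x \<circ> s \<circ> r) p \<and> p \<in> Z"
    if s: "strict_mono s" for s :: "nat \<Rightarrow> nat"
  proof -
    obtain r p where "strict_mono (r :: nat \<Rightarrow> nat)" "weakly_tendsto (x \<circ> s \<circ> r) p"
      using bounded_weak_subsequence[OF sep, of "x \<circ> s" "K + norm z"] bdd by auto
    then show ?thesis using cluster[of "s \<circ> r" p] strict_mono_o[OF s] by (auto simp: o_assoc)
  qed
  obtain r p where rp: "strict_mono (r :: nat \<Rightarrow> nat)" "weakly_tendsto (x \<circ> r) p" "p \<in> Z"
    using sub[of id] by (auto simp: strict_mono_id)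
  have unique: "q = p" if s: "strict_mono s" "weakly_tendsto (x \<circ> s) q" "q \<in> Z" for s q
  proof -
    obtain a b where a: "(\<lambda>k. norm (x k - p)) \<longlonglongrightarrow> a" and b: "(\<lambda>k. norm (x k - q)) \<longlonglongrightarrow> b"
      using conv s(3) rp(3) convergent_def by metis
    have eq: "inner (x k) (p - q) =
        ((norm (x k - q))\<^sup>2 - (norm (x k - p))\<^sup>2 + (norm p)\<^sup>2 - (norm q)\<^sup>2) / 2" for k
      unfolding power2_norm_eq_inner by (simp add: inner_diff inner_commute)
    define l where "l = (b\<^sup>2 - a\<^sup>2 + (norm p)\<^sup>2 - (norm q)\<^sup>2) / 2"
    have l: "(\<lambda>k. inner (x k) (p - q)) \<longlonglongrightarrow> l" unfolding eq l_def by (intro tendsto_intros a b) simp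
    have "inner p (p - q) = l" "inner q (p - q) = l"
      using rp(2) s(2) LIMSEQ_subseq_LIMSEQ[OF l rp(1)] LIMSEQ_subseq_LIMSEQ[OF l s(1)]
      unfolding weakly_tendsto_def o_def by (meson LIMSEQ_unique)+
    then have "inner (p - q) (p - q) = 0" by (simp only: inner_diff_left)
    then show ?thesis by simp
  qed
  \<comment> \<open>A subsequence staying away from the limit in some functional would itself have a
    weakly convergent subsequence, whose limit is \<open>p\<close> by uniqueness.\<close>
  have "weakly_tendsto x p" unfolding weakly_tendsto_def
  proof (intro allI, rule ccontr)
    fix y assume "\<not> (\<lambda>k. inner (x k) y) \<longlonglongrightarrow> inner p y"
    then obtain e where e: "0 < e" "\<And>N. \<exists>k\<ge>N. e \<le> dist (inner (x k) y) (inner p y)"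
      unfolding lim_sequentially by (meson not_le)
    then have "infinite {k. e \<le> dist (inner (x k) y) (inner p y)}"
      unfolding infinite_nat_iff_unbounded_le by auto
    then obtain s :: "nat \<Rightarrow> nat" where s: "strict_mono s" "\<And>k. e \<le> dist (inner (x (s k)) y) (inner p y)"
      using infinite_enumerate by (metis (mono_tags, lifting) mem_Collect_eq)
    obtain t q where tq: "strict_mono (t :: nat \<Rightarrow> nat)" "weakly_tendsto (x \<circ> s \<circ> t) q" "q \<in> Z"
      using sub[OF s(1)] by blast
    have "q = p" using unique[of "s \<circ> t" q] tq strict_mono_o[OF s(1) tq(1)] by (simp add: o_assoc)
    then have "(\<lambda>k. inner (x (s (t k))) y) \<longlonglongrightarrow> inner p y"
      using tq(2) unfolding weakly_tendsto_def by auto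
    then obtain k where "dist (inner (x (s (t k))) y) (inner p y) < e"
      using e(1) unfolding lim_sequentially by blast
    then show False using s(2)[of "t k"] by simp
  qed
  then show ?thesis using rp(3) by blast
qed

lemma bounded_weak_strong_inner:
  fixes x v :: "nat \<Rightarrow> 'a::real_inner"
  assumes "weakly_tendsto x p" "v \<longlonglongrightarrow> w" "\<And>k. norm (x k) \<le> K"
  shows "(\<lambda>k. inner (x k) (v k)) \<longlonglongrightarrow> inner p w"
proof -
  have "(\<lambda>k. inner (x k) (v k - w)) \<longlonglongrightarrow> 0"
  proof (rule Lim_null_comparison)
    show "\<forall>\<^sub>F k in sequentially. norm (inner (x k) (v k - w)) \<le> K * norm (v k - w)"
      using order_trans[OF Cauchy_Schwarz_ineq2 mult_right_mono[OF assms(3) norm_ge_zero]] by simp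
    have "(\<lambda>k. K * norm (v k - w)) \<longlonglongrightarrow> K * norm (w - w)" by (intro tendsto_intros assms)
    then show "(\<lambda>k. K * norm (v k - w)) \<longlonglongrightarrow> 0" by simp
  qed
  moreover have "(\<lambda>k. inner (x k) w) \<longlonglongrightarrow> inner p w" using assms(1) unfolding weakly_tendsto_def by blast
  ultimately have "(\<lambda>k. inner (x k) (v k - w) + inner (x k) w) \<longlonglongrightarrow> 0 + inner p w" by (rule tendsto_add)
  then show ?thesis by (simp add: inner_diff)
qed

lemma weakly_tendsto_perturb:
  fixes x y :: "nat \<Rightarrow> 'a::real_inner"
  assumes "weakly_tendsto x p" "(\<lambda>k. y k - x k) \<longlonglongrightarrow> 0"
  shows "weakly_tendsto y p"
  unfolding weakly_tendsto_def
proof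
  fix z
  have "(\<lambda>k. inner (x k) z) \<longlonglongrightarrow> inner p z" using assms(1) unfolding weakly_tendsto_def by blast
  from tendsto_add[OF tendsto_inner[OF assms(2) tendsto_const] this]
  have "(\<lambda>k. inner (y k - x k) z + inner (x k) z) \<longlonglongrightarrow> inner 0 z + inner p z" .
  then show "(\<lambda>k. inner (y k) z) \<longlonglongrightarrow> inner p z" by (simp add: inner_diff)
qed

text \<open>Testing the limiting inequality at the forward-backward point \<open>J (p - t B p)\<close> with
  \<open>t L < 1\<close> avoids the maximality of the sum \<open>A + B\<close>.\<close>
lemma zeros_sum_variationalI:
  fixes A :: "'a::{real_inner,complete_space} \<Rightarrow> 'a set"
  assumes A: "maximal_monotone A" and lip: "L-lipschitz_on UNIV B"
    and vi: "\<And>a b. b \<in> A a \<Longrightarrow> 0 \<le> inner (p - a) (- b - B a)"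
  shows "p \<in> zeros_sum A B"
proof -
  have L: "0 \<le> L" using lip by (rule lipschitz_on_nonneg)
  \<comment> \<open>The summand 1 covers L = 0 and makes \<open>t * L < 1\<close> strict.\<close>
  define t where "t = 1 / (L + 1)"
  have t: "0 < t" "t * L < 1" using L unfolding t_def by (auto simp: field_simps)
  obtain a b where ab: "b \<in> A a" "p - t *\<^sub>R B p = a + t *\<^sub>R b" using minty[OF A t(1)] by blast
  then have eq: "p - a = t *\<^sub>R (b + B p)" by (simp add: algebra_simps)
  have "0 \<le> inner (p - a) (t *\<^sub>R (- b - B a))" using vi[OF ab(1)] t by simp
  also have "t *\<^sub>R (- b - B a) = t *\<^sub>R (B p - B a) - (p - a)" unfolding eq by (simp add: algebra_simps)
  finally have "(norm (p - a))\<^sup>2 \<le> t * inner (p - a) (B p - B a)"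
    by (simp add: inner_diff_right power2_norm_eq_inner)
  also have "\<dots> \<le> t * (norm (p - a) * (L * norm (p - a)))"
    using t lipschitz_onD[OF lip, of p a]
    by (intro mult_left_mono order_trans[OF norm_cauchy_schwarz] mult_left_mono) (auto simp: dist_norm)
  finally have "(1 - t * L) * (norm (p - a))\<^sup>2 \<le> 0" by (simp add: power2_eq_square algebra_simps)
  then have "(norm (p - a))\<^sup>2 \<le> 0" using t by (simp add: mult_le_0_iff)
  then have "p = a" by simp
  moreover from this have "b + B p = 0" using eq t by simp
  ultimately show ?thesis using ab(1) unfolding zeros_sum_def by blast
qed

section \<open>Convergence of nonnegative supermartingales\<close>

text \<open>The state after \<open>k\<close> observations: the number of completed upcrossings of \<open>[a, b]\<close> and
  whether one is in progress.\<close>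
primrec upcrossings :: "real \<Rightarrow> real \<Rightarrow> (nat \<Rightarrow> real) \<Rightarrow> nat \<Rightarrow> nat \<times> bool" where
  "upcrossings a b y 0 = (0, False)"
| "upcrossings a b y (Suc k) = (let (u, s) = upcrossings a b y k in
     if s then (if b \<le> y k then (Suc u, False) else (u, True)) else (u, y k \<le> a))"

text \<open>The state after \<open>k\<close> observations reads only the values before time
  \<open>k\<close>; this is the predictability of the trading strategy, and it makes the state a
  function of a finite word.\<close>

lemma upcrossings_cong:
  "(\<And>j. j < k \<Longrightarrow> y j = y' j) \<Longrightarrow> upcrossings a b y k = upcrossings a b y' k"
  by (induction k) (auto split: prod.split)

lemma mono_upcrossings: "mono (\<lambda>k. fst (upcrossings a b y k))"
  by (rule monoI, rule lift_Suc_mono_le) (auto split: prod.split)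

text \<open>The right-hand side is the gain from holding the asset \<open>y\<close> exactly during upcrossings.\<close>
lemma upcrossings_le_gain:
  assumes nn: "\<And>k. 0 \<le> y k" and ab: "0 \<le> a" "a < b"
  shows "(b - a) * real (fst (upcrossings a b y k)) \<le>
    a + (\<Sum>j<k. if snd (upcrossings a b y (Suc j)) then y (Suc j) - y j else 0)"
proof -
  define gain where
    "gain k = (\<Sum>j<k. if snd (upcrossings a b y (Suc j)) then y (Suc j) - y j else 0)" for k
  \<comment> \<open>Each closed position has earned at least \<open>b - a\<close>. An open one was
    bought at a price of at most \<open>a\<close>, so its gain up to time \<open>k\<close> is at
    least \<open>y k - a\<close>.\<close>
  have inv: "(b - a) * real (fst (upcrossings a b y (Suc k))) +
      (if snd (upcrossings a b y (Suc k)) then y k - a else 0) \<le> gain k" for k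
  proof (induction k)
    case 0
    then show ?case by (simp add: gain_def)
  next
    case (Suc k)
    obtain u s where us: "upcrossings a b y (Suc k) = (u, s)" by fastforce
    have gain: "gain (Suc k) = gain k + (if s then y (Suc k) - y k else 0)"
      using us unfolding gain_def by simp
    have up: "upcrossings a b y (Suc (Suc k)) =
        (if s then (if b \<le> y (Suc k) then (Suc u, False) else (u, True)) else (u, y (Suc k) \<le> a))"
      unfolding upcrossings.simps(2)[of a b y "Suc k"] us by simp
    have IH: "(b - a) * real u + (if s then y k - a else 0) \<le> gain k" using Suc us by simp
    show ?case
      unfolding up gain using IH by (cases s) (auto simp: algebra_simps)
  qed
  have "fst (upcrossings a b y k) \<le> fst (upcrossings a b y (Suc k))"
    using mono_upcrossings by (rule monoD) simp
  then have "(b - a) * real (fst (upcrossings a b y k)) \<le> (b - a) * real (fst (upcrossings a b y (Suc k)))"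
    using ab by (intro mult_left_mono) auto
  \<comment> \<open>Since \<open>y k\<close> is nonnegative, an open position has lost at most
    \<open>a\<close>.\<close>
  also have "\<dots> \<le> a + gain k" using inv[of k] nn[of k] ab by (simp split: if_splits)
  finally show ?thesis unfolding gain_def .
qed

text \<open>Once the count has reached its maximum, either a position is open at some later time and
  never closes, so \<open>y\<close> stays below \<open>b\<close>, or none ever opens, so
  \<open>y\<close> stays above \<open>a\<close>.\<close>

lemma bounded_upcrossings_dichotomy:
  assumes bdd: "\<And>k. fst (upcrossings a b y k) \<le> N"
  shows "(\<forall>\<^sub>F k in sequentially. a < y k) \<or> (\<forall>\<^sub>F k in sequentially. y k < b)"
proof -
  define U where "U k = fst (upcrossings a b y k)" for k
  define m where "m = Max (range U)"
  have fin: "finite (range U)" using bdd by (auto simp: U_def intro!: finite_subset[of _ "{..N}"])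
  then have "m \<in> range U" unfolding m_def by (intro Max_in) auto
  then obtain K where K: "U K = m" by auto
  have const: "U k = m" if "k \<ge> K" for k
    using monoD[OF mono_upcrossings that, of a b y] Max_ge[OF fin, of "U k"] K
    unfolding U_def m_def by auto
  define s where "s k = snd (upcrossings a b y k)" for k
  have step: "upcrossings a b y (Suc k) = (if s k then (if b \<le> y k then (Suc (U k), False) else (U k, True))
      else (U k, y k \<le> a))" for k
    unfolding U_def s_def by (simp split: prod.split)
  show ?thesis
  proof (cases "\<exists>j\<ge>K. s j")
    case True
    then obtain j where j: "j \<ge> K" "s j" by blast
    have below: "y l < b" if "l \<ge> K" "s l" for l
      using step[of l] const[of l] const[of "Suc l"] that U_def[of "Suc l"] by (auto split: if_splits)
    have "s l" if "l \<ge> j" for l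
      using that
    proof (induction l rule: dec_induct)
      case (step l)
      then show ?case using below[of l] j \<open>\<And>k. upcrossings a b y (Suc k) = _ k\<close>[of l]
        by (simp add: s_def[of "Suc l"])
    qed (use j in auto)
    then show ?thesis using below j(1) unfolding eventually_sequentially
      by (intro disjI2 exI[of _ j]) auto
  next
    case False
    then have "a < y k" if "k \<ge> K" for k
      using step[of k] that False[simplified, rule_format, of "Suc k"] by (auto simp: s_def split: if_splits)
    then show ?thesis unfolding eventually_sequentially by blast
  qed
qed

text \<open>Two rationals strictly between liminf and limsup would contradict \<open>osc\<close>,
  and \<open>fin\<close> excludes the common value infinity. Rational levels keep the number of null
  sets countable in the application.\<close>

lemma convergent_if_no_oscillation:
  fixes y :: "nat \<Rightarrow> real"
  assumes nn: "\<And>k. 0 \<le> y k"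
    and osc: "\<And>a b :: rat. 0 \<le> a \<Longrightarrow> a < b \<Longrightarrow>
      (\<forall>\<^sub>F k in sequentially. of_rat a < y k) \<or> (\<forall>\<^sub>F k in sequentially. y k < of_rat b)"
    and fin: "\<not> filterlim y at_top sequentially"
  shows "convergent y"
proof -
  let ?Y = "\<lambda>k. ereal (y k)"
  have ge0: "0 \<le> liminf ?Y" using nn by (intro Liminf_bounded) auto
  have "\<not> liminf ?Y < limsup ?Y"
  proof
    assume "liminf ?Y < limsup ?Y"
    then obtain b :: rat where b: "liminf ?Y < ereal (of_rat b)" "ereal (of_rat b) < limsup ?Y"
      using ereal_dense3 by blast
    then obtain a :: rat where a: "liminf ?Y < ereal (of_rat a)" "ereal (of_rat a) < ereal (of_rat b)"
      using ereal_dense3 by blast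
    have "ereal 0 < ereal (of_rat a)" using le_less_trans[OF ge0 a(1)] by (simp add: zero_ereal_def)
    then have "0 \<le> a" "a < b" using a(2) by (simp_all add: of_rat_less)
    then consider "\<forall>\<^sub>F k in sequentially. of_rat a < y k" | "\<forall>\<^sub>F k in sequentially. y k < of_rat b"
      using osc by blast
    then show False
    proof cases
      case 1
      have "ereal (of_rat a) \<le> liminf ?Y"
        using 1 by (intro Liminf_bounded) (auto elim: eventually_mono)
      then show False using a(1) by simp
    next
      case 2
      have "limsup ?Y \<le> ereal (of_rat b)"
        using 2 by (intro Limsup_bounded) (auto elim: eventually_mono)
      then show False using b(2) by simp
    qed
  qed
  moreover have "liminf ?Y \<le> limsup ?Y" by (rule Liminf_le_Limsup) simp
  ultimately have eq: "limsup ?Y = liminf ?Y" by simp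
  obtain l where l: "liminf ?Y = ereal l" using ge0 fin Liminf_PInfty[of sequentially ?Y]
    by (cases "liminf ?Y") (auto simp: tendsto_PInfty_eq_at_top)
  have "?Y \<longlonglongrightarrow> ereal l" using eq l by (intro Liminf_eq_Limsup) auto
  then show ?thesis unfolding convergent_def by auto
qed

section \<open>Expectations of functions of the random index word\<close>

locale uniform_indices = prob_space M for M :: "'w measure" +
  fixes I :: "nat \<Rightarrow> 'w \<Rightarrow> nat" and n :: nat
  assumes n_pos: "n \<ge> 1"
    and indep: "indep_vars (\<lambda>_. count_space UNIV) I UNIV"
    and unif: "\<And>k. distr M (count_space UNIV) (I k) = measure_pmf (pmf_of_set {1..n})"
begin

definition hist :: "nat \<Rightarrow> 'w \<Rightarrow> nat list" where
  "hist k \<omega> = map (\<lambda>j. I j \<omega>) [0..<k]"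

definition words :: "nat \<Rightarrow> nat list set" where
  "words k = {w. set w \<subseteq> {1..n} \<and> length w = k}"

lemma length_hist [simp]: "length (hist k \<omega>) = k"
  by (simp add: hist_def)

lemma hist_0 [simp]: "hist 0 \<omega> = []"
  by (simp add: hist_def)

lemma hist_Suc: "hist (Suc k) \<omega> = hist k \<omega> @ [I k \<omega>]"
  by (simp add: hist_def)

lemma take_hist: "j \<le> k \<Longrightarrow> take j (hist k \<omega>) = hist j \<omega>"
  by (simp add: hist_def take_map take_upt)

lemma measurable_I [measurable]: "I k \<in> M \<rightarrow>\<^sub>M count_space UNIV"
  using indep unfolding indep_vars_def by auto

lemma measurable_hist [measurable]: "hist k \<in> M \<rightarrow>\<^sub>M count_space UNIV"
proof (induction k)
  case 0
  then show ?case by (simp add: hist_def[abs_def])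
next
  case (Suc k)
  have "(\<lambda>\<omega>. (\<lambda>h \<omega>. h @ [I k \<omega>]) (hist k \<omega>) \<omega>) \<in> M \<rightarrow>\<^sub>M count_space UNIV"
    by (rule measurable_compose_countable[OF measurable_compose[OF measurable_I] Suc]) simp
  then show ?case by (simp add: hist_Suc[abs_def])
qed

text \<open>On the discrete space of words every function is measurable, so the iterates are random
  variables without any continuity argument for the resolvent.\<close>

lemma borel_measurable_hist [measurable]:
  "(\<lambda>\<omega>. f (hist k \<omega>)) \<in> M \<rightarrow>\<^sub>M (borel :: 'b::topological_space measure)"
  by (rule measurable_compose[OF measurable_hist]) simp

lemma prob_I: "i \<in> {1..n} \<Longrightarrow> prob (I k -` {i} \<inter> space M) = 1 / real n"
  using measure_distr[OF measurable_I, of "{i}" k] n_pos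
  by (simp add: unif measure_pmf_single pmf_of_set)

text \<open>Only the distribution of the indices is prescribed, so values outside the range may
  occur on a null set, and there \<open>Bi\<close> is unconstrained.\<close>

lemma AE_indices: "AE \<omega> in M. \<forall>k. I k \<omega> \<in> {1..n}"
  unfolding AE_all_countable
proof
  fix k
  have "AE i in distr M (count_space UNIV) (I k). i \<in> {1..n}"
    unfolding unif using n_pos by (simp add: AE_measure_pmf_iff set_pmf_of_set)
  then show "AE \<omega> in M. I k \<omega> \<in> {1..n}" by (rule AE_distrD[OF measurable_I])
qed

lemma hist_in_words: "(\<And>k. I k \<omega> \<in> {1..n}) \<Longrightarrow> hist k \<omega> \<in> words k"
  by (auto simp: hist_def words_def)

lemma finite_words: "finite (words k)"
  unfolding words_def by (rule finite_lists_length_eq) simp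

lemma prob_hist:
  assumes w: "w \<in> words k"
  shows "prob (hist k -` {w} \<inter> space M) = (1 / real n) ^ k"
proof (cases "k = 0")
  \<comment> \<open>Independence gives a product formula for nonempty index sets only, so the empty
    word is treated apart.\<close>
  case True
  then have "hist k -` {w} \<inter> space M = space M" using w by (auto simp: words_def)
  then show ?thesis using True by (simp add: prob_space)
next
  case False
  have len: "length w = k" using w by (simp add: words_def)
  have "hist k \<omega> = w \<longleftrightarrow> (\<forall>j<k. I j \<omega> = w ! j)" for \<omega>
    unfolding list_eq_iff_nth_eq length_hist len by (simp add: hist_def)
  then have "hist k -` {w} \<inter> space M = (\<Inter>j\<in>{..<k}. I j -` {w ! j} \<inter> space M)"
    using False by force
  also have "prob \<dots> = (\<Prod>j\<in>{..<k}. prob (I j -` {w ! j} \<inter> space M))"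
  proof (rule indep_setsD)
    show "indep_sets (\<lambda>i. {I i -` A \<inter> space M |A. A \<in> sets (count_space UNIV)}) UNIV"
      using indep unfolding indep_vars_def2 by auto
  qed (use False in auto)
  also have "\<dots> = (\<Prod>j\<in>{..<k}. 1 / real n)"
  proof (intro prod.cong refl prob_I)
    fix j assume "j \<in> {..<k}"
    then have "w ! j \<in> set w" using len by simp
    then show "w ! j \<in> {1..n}" using w unfolding words_def by blast
  qed
  finally show ?thesis by simp
qed

text \<open>Up to a null set the history takes finitely many values, so the integrand is a finite
  combination of indicators of equally likely words.\<close>

lemma
  fixes f :: "nat list \<Rightarrow> real"
  shows integrable_hist: "integrable M (\<lambda>\<omega>. f (hist k \<omega>))"
    and expectation_hist: "expectation (\<lambda>\<omega>. f (hist k \<omega>)) = (\<Sum>w\<in>words k. f w) * (1 / real n) ^ k"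
proof -
  let ?g = "\<lambda>\<omega>. \<Sum>w\<in>words k. f w * indicator (hist k -` {w} \<inter> space M) \<omega>"
  have meas: "hist k -` {w} \<inter> space M \<in> sets M" for w by measurable
  have "AE \<omega> in M. f (hist k \<omega>) = ?g \<omega>"
    using AE_indices AE_space
  proof eventually_elim
    case (elim \<omega>)
    have "?g \<omega> = (\<Sum>w\<in>words k. if w = hist k \<omega> then f w else 0)"
      using elim(2) by (intro sum.cong) auto
    also have "\<dots> = f (hist k \<omega>)"
      using elim(1) hist_in_words[of \<omega> k] finite_words by (simp add: sum.delta)
    finally show ?case by simp
  qed
  moreover have int: "integrable M ?g"
    by (intro Bochner_Integration.integrable_sum integrable_mult_right integrable_real_indicator meas)
      (simp add: emeasure_eq_measure)
  moreover have "expectation ?g = (\<Sum>w\<in>words k. f w * prob (hist k -` {w} \<inter> space M))"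
    by (subst Bochner_Integration.integral_sum)
      (auto intro!: integrable_mult_right integrable_real_indicator meas simp: emeasure_eq_measure)
  ultimately show "integrable M (\<lambda>\<omega>. f (hist k \<omega>))"
    and "expectation (\<lambda>\<omega>. f (hist k \<omega>)) = (\<Sum>w\<in>words k. f w) * (1 / real n) ^ k"
    using integrable_cong_AE[of "\<lambda>\<omega>. f (hist k \<omega>)" M ?g] integral_cong_AE[of "\<lambda>\<omega>. f (hist k \<omega>)" M ?g]
      borel_measurable_integrable[OF int]
    by (simp_all add: prob_hist sum_distrib_right)
qed

lemma words_Suc: "words (Suc k) = (\<lambda>(w, i). w @ [i]) ` (words k \<times> {1..n})"
proof (intro set_eqI iffI)
  fix u assume u: "u \<in> words (Suc k)"
  then have "u \<noteq> []" by (auto simp: words_def)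
  then have "u = butlast u @ [last u]" by simp
  moreover have "butlast u \<in> words k" "last u \<in> {1..n}"
    using u last_in_set[OF \<open>u \<noteq> []\<close>] by (auto simp: words_def dest: in_set_butlastD)
  ultimately show "u \<in> (\<lambda>(w, i). w @ [i]) ` (words k \<times> {1..n})" by force
qed (auto simp: words_def)

text \<open>This plays the part of the tower property; it is the sum over words regrouped by their
  last letter.\<close>

lemma expectation_hist_Suc:
  fixes f :: "nat list \<Rightarrow> real"
  shows "expectation (\<lambda>\<omega>. f (hist (Suc k) \<omega>)) =
    expectation (\<lambda>\<omega>. (\<Sum>i=1..n. f (hist k \<omega> @ [i])) / real n)"
proof -
  have "(\<Sum>u\<in>words (Suc k). f u) = (\<Sum>w\<in>words k. \<Sum>i=1..n. f (w @ [i]))"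
    unfolding words_Suc by (subst sum.reindex) (auto simp: inj_on_def sum.cartesian_product case_prod_beta)
  then show ?thesis
    using expectation_hist[of f "Suc k"] expectation_hist[of "\<lambda>w. (\<Sum>i=1..n. f (w @ [i])) / real n" k]
    n_pos by (simp add: sum_divide_distrib[symmetric])
qed

lemma AE_hist_words: "AE \<omega> in M. \<forall>k. hist k \<omega> \<in> words k"
  using AE_indices by eventually_elim (auto intro: hist_in_words)

section \<open>Doob's upcrossing argument\<close>

context
  fixes v :: "nat list \<Rightarrow> real"
  assumes nonneg: "\<And>w. 0 \<le> v w"
    and super: "\<And>w. set w \<subseteq> {1..n} \<Longrightarrow> (\<Sum>i=1..n. v (w @ [i])) / real n \<le> v w"
begin

lemma expectation_supermartingale_le: "expectation (\<lambda>\<omega>. v (hist k \<omega>)) \<le> v []"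
proof (induction k)
  case 0
  then show ?case by (simp add: prob_space)
next
  case (Suc k)
  have "expectation (\<lambda>\<omega>. v (hist (Suc k) \<omega>)) \<le> expectation (\<lambda>\<omega>. v (hist k \<omega>))"
    unfolding expectation_hist_Suc
    by (rule integral_mono_AE[OF integrable_hist integrable_hist])
      (use AE_hist_words in eventually_elim, use super in \<open>auto simp: words_def\<close>)
  then show ?case using Suc by linarith
qed

text \<open>By Fatou's lemma the liminf has expectation at most \<open>v []\<close>, so it is finite
  almost surely.\<close>

lemma AE_supermartingale_not_at_top: "AE \<omega> in M. \<not> filterlim (\<lambda>k. v (hist k \<omega>)) at_top sequentially"
proof -
  have "(\<integral>\<^sup>+\<omega>. liminf (\<lambda>k. ennreal (v (hist k \<omega>))) \<partial>M) \<le> liminf (\<lambda>k. \<integral>\<^sup>+\<omega>. ennreal (v (hist k \<omega>)) \<partial>M)"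
    by (rule nn_integral_liminf) measurable
  also have "\<dots> \<le> ennreal (v [])"
    by (rule Liminf_le) (auto simp: nn_integral_eq_integral[OF integrable_hist] nonneg
        intro!: always_eventually ennreal_leI expectation_supermartingale_le)
  finally have "(\<integral>\<^sup>+\<omega>. liminf (\<lambda>k. ennreal (v (hist k \<omega>))) \<partial>M) \<noteq> \<infinity>"
    by (auto simp: top_unique)
  then have "AE \<omega> in M. liminf (\<lambda>k. ennreal (v (hist k \<omega>))) \<noteq> \<infinity>"
    by (intro nn_integral_PInf_AE) auto
  then show ?thesis
    by eventually_elim
      (auto simp: ennreal_tendsto_top_eq_at_top[symmetric] dest: lim_imp_Liminf[rotated])
qed

text \<open>Doob's upcrossing inequality. A predictable nonnegative stake on a supermartingale has
  expected gain at most 0, while each upcrossing earns \<open>b - a\<close> and the total loss never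
  exceeds \<open>a\<close>.\<close>

lemma expectation_upcrossings_le:
  assumes ab: "0 \<le> a" "a < b"
  shows "expectation (\<lambda>\<omega>. real (fst (upcrossings a b (\<lambda>j. v (hist j \<omega>)) k))) \<le> a / (b - a)"
proof -
  \<comment> \<open>The stake for the step after the word \<open>w\<close>. The state at
    \<open>Suc (length w)\<close> has read the values up to \<open>v w\<close> and nothing later, so
    the stake is known before the next letter.\<close>
  define s where "s w = (if snd (upcrossings a b (\<lambda>j. v (take j w)) (Suc (length w))) then 1 else 0 :: real)" for w
  define g where "g w = s (butlast w) * (v w - v (butlast w))" for w
  have s: "s (hist j \<omega>) = (if snd (upcrossings a b (\<lambda>j. v (hist j \<omega>)) (Suc j)) then 1 else 0)" for j \<omega>
    unfolding s_def length_hist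
    by (subst upcrossings_cong[of "Suc j" "\<lambda>i. v (take i (hist j \<omega>))" "\<lambda>i. v (hist i \<omega>)"])
      (auto simp: take_hist)
  have g: "g (hist (Suc j) \<omega>) = (if snd (upcrossings a b (\<lambda>j. v (hist j \<omega>)) (Suc j))
      then v (hist (Suc j) \<omega>) - v (hist j \<omega>) else 0)" for j \<omega>
    unfolding g_def hist_Suc butlast_snoc s by simp
  have Eg: "expectation (\<lambda>\<omega>. g (hist (Suc j) \<omega>)) \<le> 0" for j
  proof -
    \<comment> \<open>The stake is fixed by \<open>w\<close>, so it factors out of the average over
      the next letter.\<close>
    have eq: "(\<Sum>i=1..n. g (w @ [i])) / real n = s w * ((\<Sum>i=1..n. v (w @ [i])) / real n - v w)" for w
      unfolding g_def using n_pos by (simp add: sum_distrib_left[symmetric] sum_subtractf field_simps)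
    have "AE \<omega> in M. (\<Sum>i=1..n. g (hist j \<omega> @ [i])) / real n \<le> 0"
      using AE_hist_words
    proof eventually_elim
      case (elim \<omega>)
      then have "set (hist j \<omega>) \<subseteq> {1..n}" by (auto simp: words_def)
      then show ?case unfolding eq using super[of "hist j \<omega>"]
        by (intro mult_nonneg_nonpos) (auto simp: s_def)
    qed
    then have "expectation (\<lambda>\<omega>. (\<Sum>i=1..n. g (hist j \<omega> @ [i])) / real n) \<le> expectation (\<lambda>\<omega>. 0)"
      by (intro integral_mono_AE integrable_hist) auto
    then show ?thesis unfolding expectation_hist_Suc by simp
  qed
  define U where "U w = real (fst (upcrossings a b (\<lambda>j. v (take j w)) (length w)))" for w
  have U: "U (hist k \<omega>) = real (fst (upcrossings a b (\<lambda>j. v (hist j \<omega>)) k))" for \<omega>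
    unfolding U_def length_hist
    by (subst upcrossings_cong[of k "\<lambda>i. v (take i (hist k \<omega>))" "\<lambda>i. v (hist i \<omega>)"])
      (auto simp: take_hist)
  have "(b - a) * U (hist k \<omega>) \<le> a + (\<Sum>j<k. g (hist (Suc j) \<omega>))" for \<omega>
    unfolding U g by (rule upcrossings_le_gain[OF nonneg ab])
  then have "expectation (\<lambda>\<omega>. (b - a) * U (hist k \<omega>)) \<le> expectation (\<lambda>\<omega>. a + (\<Sum>j<k. g (hist (Suc j) \<omega>)))"
    by (intro integral_mono Bochner_Integration.integrable_add integrable_const
        Bochner_Integration.integrable_sum integrable_mult_right integrable_hist)
  also have "\<dots> = a + (\<Sum>j<k. expectation (\<lambda>\<omega>. g (hist (Suc j) \<omega>)))"
    using integrable_hist by (simp add: prob_space)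
  also have "\<dots> \<le> a" using Eg by (simp add: sum_nonpos)
  finally have "(b - a) * expectation (\<lambda>\<omega>. U (hist k \<omega>)) \<le> a" by simp
  then show ?thesis using ab unfolding U by (simp add: pos_le_divide_eq mult.commute)
qed

text \<open>The bound on the expectation is uniform in the horizon, so by monotone convergence the
  total number of upcrossings has finite expectation.\<close>

lemma AE_upcrossings_bounded:
  assumes ab: "0 \<le> a" "a < b"
  shows "AE \<omega> in M. \<exists>N. \<forall>k. fst (upcrossings a b (\<lambda>j. v (hist j \<omega>)) k) \<le> N"
proof -
  define U where "U k \<omega> = real (fst (upcrossings a b (\<lambda>j. v (hist j \<omega>)) k))" for k \<omega>
  have U: "U k = (\<lambda>\<omega>. (\<lambda>w. real (fst (upcrossings a b (\<lambda>j. v (take j w)) k))) (hist k \<omega>))" for k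
  proof
    fix \<omega>
    show "U k \<omega> = real (fst (upcrossings a b (\<lambda>j. v (take j (hist k \<omega>))) k))"
      unfolding U_def
      by (subst upcrossings_cong[of k "\<lambda>i. v (take i (hist k \<omega>))" "\<lambda>i. v (hist i \<omega>)"])
        (auto simp: take_hist)
  qed
  have meas [measurable]: "U k \<in> borel_measurable M" for k unfolding U by (rule borel_measurable_hist)
  have int: "integrable M (U k)" for k unfolding U by (rule integrable_hist)
  have "incseq (\<lambda>k \<omega>. ennreal (U k \<omega>))"
    using mono_upcrossings by (auto simp: incseq_def le_fun_def U_def mono_def intro!: ennreal_leI)
  then have "(\<integral>\<^sup>+\<omega>. (SUP k. ennreal (U k \<omega>)) \<partial>M) = (SUP k. \<integral>\<^sup>+\<omega>. ennreal (U k \<omega>) \<partial>M)"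
    by (intro nn_integral_monotone_convergence_SUP) auto
  also have "\<dots> \<le> ennreal (a / (b - a))"
  proof (rule SUP_least)
    fix k
    have "(\<integral>\<^sup>+\<omega>. ennreal (U k \<omega>) \<partial>M) = ennreal (expectation (U k))"
      by (rule nn_integral_eq_integral[OF int]) (simp add: U_def)
    also have "\<dots> \<le> ennreal (a / (b - a))"
      using expectation_upcrossings_le[OF ab, of k] unfolding U_def by (rule ennreal_leI)
    finally show "(\<integral>\<^sup>+\<omega>. ennreal (U k \<omega>) \<partial>M) \<le> ennreal (a / (b - a))" .
  qed
  finally have "(\<integral>\<^sup>+\<omega>. (SUP k. ennreal (U k \<omega>)) \<partial>M) \<noteq> \<infinity>" by (auto simp: top_unique)
  then have "AE \<omega> in M. (SUP k. ennreal (U k \<omega>)) \<noteq> \<infinity>" by (intro nn_integral_PInf_AE) auto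
  then show ?thesis
  proof eventually_elim
    case (elim \<omega>)
    then obtain r where r: "(SUP k. ennreal (U k \<omega>)) = ennreal r" "0 \<le> r"
      by (cases "SUP k. ennreal (U k \<omega>)") auto
    have "fst (upcrossings a b (\<lambda>j. v (hist j \<omega>)) k) \<le> nat \<lfloor>r\<rfloor>" for k
    proof -
      have "ennreal (U k \<omega>) \<le> ennreal r" unfolding r(1)[symmetric] by (rule SUP_upper) simp
      then have "U k \<omega> \<le> r" using r(2) by simp
      then show ?thesis unfolding U_def by (simp add: le_nat_floor)
    qed
    then show ?case by blast
  qed
qed

lemma AE_nonneg_supermartingale_convergent: "AE \<omega> in M. convergent (\<lambda>k. v (hist k \<omega>))"
proof -
  have "AE \<omega> in M. \<forall>a b :: rat. 0 \<le> a \<and> a < b \<longrightarrow>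
      (\<exists>N. \<forall>k. fst (upcrossings (of_rat a) (of_rat b) (\<lambda>j. v (hist j \<omega>)) k) \<le> N)"
    unfolding AE_all_countable
  proof (intro allI)
    fix a b :: rat
    show "AE \<omega> in M. 0 \<le> a \<and> a < b \<longrightarrow>
      (\<exists>N. \<forall>k. fst (upcrossings (of_rat a) (of_rat b) (\<lambda>j. v (hist j \<omega>)) k) \<le> N)"
      using AE_upcrossings_bounded[of "of_rat a" "of_rat b"]
      by (cases "0 \<le> a \<and> a < b") (auto simp: of_rat_less)
  qed
  then show ?thesis
    using AE_supermartingale_not_at_top
  proof eventually_elim
    case (elim \<omega>)
    show ?case
    proof (rule convergent_if_no_oscillation)
      fix a b :: rat assume "0 \<le> a" "a < b"
      then obtain N where "\<And>k. fst (upcrossings (of_rat a) (of_rat b) (\<lambda>j. v (hist j \<omega>)) k) \<le> N"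
        using elim(1) by blast
      then show "(\<forall>\<^sub>F k in sequentially. of_rat a < v (hist k \<omega>)) \<or>
          (\<forall>\<^sub>F k in sequentially. v (hist k \<omega>) < of_rat b)"
        by (rule bounded_upcrossings_dichotomy)
    qed (use nonneg elim in auto)
  qed
qed

end

text \<open>The Robbins--Siegmund theorem without perturbation: adding the accumulated decrease
  to \<open>v\<close> gives a nonnegative supermartingale again.\<close>
lemma AE_supermartingale_decrease_summable:
  fixes v e :: "nat list \<Rightarrow> real"
  assumes v: "\<And>w. 0 \<le> v w" and e: "\<And>w. 0 \<le> e w"
    and super: "\<And>w. set w \<subseteq> {1..n} \<Longrightarrow> (\<Sum>i=1..n. v (w @ [i])) / real n \<le> v w - e w"
  shows "AE \<omega> in M. convergent (\<lambda>k. v (hist k \<omega>)) \<and> summable (\<lambda>k. e (hist k \<omega>))"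
proof -
  \<comment> \<open>The sum stops before \<open>w\<close> itself: the decrease \<open>e w\<close>
    enters with the next letter, exactly where \<open>super\<close> subtracts it.\<close>
  define z where "z w = v w + (\<Sum>j<length w. e (take j w))" for w
  have "AE \<omega> in M. convergent (\<lambda>k. z (hist k \<omega>))"
  proof (rule AE_nonneg_supermartingale_convergent)
    fix w show "0 \<le> z w" unfolding z_def using v e by (simp add: sum_nonneg)
  next
    fix w assume w: "set w \<subseteq> {1..n}"
    have "z (w @ [i]) = v (w @ [i]) + ((\<Sum>j<length w. e (take j w)) + e w)" for i
      unfolding z_def by simp
    then show "(\<Sum>i=1..n. z (w @ [i])) / real n \<le> z w"
      using super[OF w] n_pos by (simp add: sum.distrib z_def add_divide_distrib)
  qed
  then show ?thesis
  proof eventually_elim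
    case (elim \<omega>)
    have z: "z (hist k \<omega>) = v (hist k \<omega>) + (\<Sum>j<k. e (hist j \<omega>))" for k
      unfolding z_def by (simp add: take_hist)
    obtain C where C: "\<And>k. norm (z (hist k \<omega>)) \<le> C"
      using convergent_imp_Bseq[OF elim] unfolding Bseq_def by blast
    have "(\<Sum>j<k. e (hist j \<omega>)) \<le> C" for k
      using C[of k] v[of "hist k \<omega>"] unfolding z by (simp add: abs_le_iff)
    then have summ: "summable (\<lambda>k. e (hist k \<omega>))"
      using e by (intro summableI_nonneg_bounded)
    then have "convergent (\<lambda>k. z (hist k \<omega>) - (\<Sum>j<k. e (hist j \<omega>)))"
      by (intro convergent_diff elim) (simp add: summable_iff_convergent)
    then show ?case using summ unfolding z by simp
  qed
qed

end

section \<open>The stochastic forward-reflected-backward iteration\<close>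

lemma fbf_iter_cong:
  "(\<And>j. j < k \<Longrightarrow> idx j = idx' j) \<Longrightarrow>
    fbf_iter J B Bi lam x0 xm1 idx k = fbf_iter J B Bi lam x0 xm1 idx' k"
  by (induction k) (auto simp: Let_def split: prod.split)

lemma lipschitz_on_average:
  fixes f :: "nat \<Rightarrow> 'a::real_normed_vector \<Rightarrow> 'b::real_normed_vector"
  assumes n: "n \<ge> 1" and lip: "\<And>i. i \<in> {1..n} \<Longrightarrow> L-lipschitz_on S (f i)"
  shows "L-lipschitz_on S (\<lambda>x. (1 / real n) *\<^sub>R (\<Sum>i=1..n. f i x))"
proof (rule lipschitz_onI)
  show "0 \<le> L" using lipschitz_on_nonneg[OF lip[of 1]] n by simp
  fix x y assume xy: "x \<in> S" "y \<in> S"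
  have "norm ((\<Sum>i=1..n. f i x - f i y)) \<le> (\<Sum>i=1..n. L * dist x y)"
    using lipschitz_onD[OF lip xy] by (intro sum_norm_le) (simp add: dist_norm)
  then have "norm ((\<Sum>i=1..n. f i x - f i y)) \<le> real n * (L * dist x y)" by simp
  moreover have "dist ((1 / real n) *\<^sub>R (\<Sum>i=1..n. f i x)) ((1 / real n) *\<^sub>R (\<Sum>i=1..n. f i y))
      = norm (\<Sum>i=1..n. f i x - f i y) / real n"
    unfolding dist_norm by (simp add: sum_subtractf flip: scaleR_diff_right)
  ultimately show "dist ((1 / real n) *\<^sub>R (\<Sum>i=1..n. f i x)) ((1 / real n) *\<^sub>R (\<Sum>i=1..n. f i y)) \<le> L * dist x y"
    using n by (simp add: pos_divide_le_eq mult.commute)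
qed

text \<open>Cauchy-Schwarz and Young's inequality with equal weights.\<close>

lemma inner_le_half_sum_squares:
  fixes u d :: "'a::real_inner"
  assumes d: "norm d \<le> L * c" and L: "0 \<le> L"
  shows "2 * \<bar>inner u d\<bar> \<le> L * ((norm u)\<^sup>2 + c\<^sup>2)"
proof -
  have "2 * \<bar>inner u d\<bar> \<le> 2 * (norm u * (L * c))"
    using order_trans[OF Cauchy_Schwarz_ineq2 mult_left_mono[OF d norm_ge_zero]] by simp
  also have "\<dots> = L * (2 * norm u * c)" by simp
  also have "\<dots> \<le> L * ((norm u)\<^sup>2 + c\<^sup>2)"
    using sum_squares_bound[of "norm u" c] L by (intro mult_left_mono) auto
  finally show ?thesis .
qed

text \<open>One step for a fixed index, with \<open>y\<close> the previous iterate and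
  \<open>d\<close> the sampled difference. Monotonicity of A and of B, each between x' and z, is
  combined with the three-point identity; on the right \<open>d\<close> enters only linearly, ready
  to be averaged.\<close>

lemma forward_reflected_backward_step:
  fixes A :: "'a::{real_inner,complete_space} \<Rightarrow> 'a set"
  assumes A: "maximal_monotone A" and lam: "0 < lam" and B: "monotone_map B"
    and z: "z \<in> zeros_sum A B" and L: "0 \<le> L" and d: "norm d \<le> L * norm (x - y)"
    and x': "x' = resolvent lam A (x - lam *\<^sub>R B x - lam *\<^sub>R d)"
  shows "(norm (x' - z))\<^sup>2 - 2 * lam * inner (x' - z) (B x' - B x) + (1 - lam * L) * (norm (x' - x))\<^sup>2
    \<le> (norm (x - z))\<^sup>2 - 2 * lam * inner (x - z) d + lam * L * (norm (x - y))\<^sup>2"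
proof -
  obtain u where u: "u \<in> A x'" "x - lam *\<^sub>R B x - lam *\<^sub>R d = x' + lam *\<^sub>R u"
    using resolvent_inclusion[OF A lam] unfolding x' by blast
  have lu: "lam *\<^sub>R u = x - x' - lam *\<^sub>R B x - lam *\<^sub>R d" using u(2) by (simp add: algebra_simps)
  have Bz: "- B z \<in> A z" using z unfolding zeros_sum_def by (auto simp: add_eq_0_iff)
  have "0 \<le> lam * inner (x' - z) (u - (- B z))"
    using maximal_monotoneD[OF A u(1) Bz] lam by simp
  also have "\<dots> = inner (x' - z) (lam *\<^sub>R u) + lam * inner (x' - z) (B z)"
    by (simp add: inner_add_right algebra_simps)
  finally have 1: "0 \<le> inner (x' - z) (x - x') - lam * inner (x' - z) (B x) - lam * inner (x' - z) d
      + lam * inner (x' - z) (B z)"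
    unfolding lu by (simp add: inner_diff_right)
  have 2: "0 \<le> lam * inner (x' - z) (B x') - lam * inner (x' - z) (B z)"
    using B lam unfolding monotone_map_def by (simp add: inner_diff_right flip: right_diff_distrib)
  have 3: "2 * inner (x' - z) (x - x') = (norm (x - z))\<^sup>2 - (norm (x' - z))\<^sup>2 - (norm (x' - x))\<^sup>2"
    unfolding power2_norm_eq_inner by (simp add: inner_diff inner_commute)
  \<comment> \<open>x is known before the index is drawn, x' is not; only the second summand has to
    be estimated.\<close>
  have 4: "inner (x' - z) d = inner (x - z) d + inner (x' - x) d" by (simp add: inner_diff)
  have "2 * \<bar>inner (x' - x) d\<bar> \<le> L * ((norm (x' - x))\<^sup>2 + (norm (x - y))\<^sup>2)"
    by (rule inner_le_half_sum_squares[OF d L])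
  then have "- (2 * inner (x' - x) d) \<le> L * ((norm (x' - x))\<^sup>2 + (norm (x - y))\<^sup>2)" by linarith
  from mult_left_mono[OF this, of lam] have 5: "- (2 * (lam * inner (x' - x) d))
      \<le> lam * L * (norm (x' - x))\<^sup>2 + lam * L * (norm (x - y))\<^sup>2"
    using lam by (simp add: algebra_simps)
  have 6: "lam * inner (x' - z) (B x' - B x) = lam * inner (x' - z) (B x') - lam * inner (x' - z) (B x)"
    by (simp add: inner_diff_right algebra_simps)
  have 7: "lam * inner (x' - z) d = lam * inner (x - z) d + lam * inner (x' - x) d"
    unfolding 4 by (simp add: algebra_simps)
  have "(1 - lam * L) * (norm (x' - x))\<^sup>2 = (norm (x' - x))\<^sup>2 - lam * L * (norm (x' - x))\<^sup>2"
    by (simp add: algebra_simps)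
  then show ?thesis using 1 2 3 5 6 7 by linarith
qed

section \<open>Countable approximation and measurability in separable spaces\<close>

text \<open>\<open>D\<close> may miss \<open>S\<close> altogether, so for each of its points and
  each scale 1/(m+1) one nearby point of \<open>S\<close> is selected, if there is one.\<close>

lemma countable_dense_subset:
  fixes S :: "'a::metric_space set"
  assumes sep: "\<exists>D::'a set. countable D \<and> closure D = UNIV"
  shows "\<exists>Q. countable Q \<and> Q \<subseteq> S \<and> S \<subseteq> closure Q"
proof -
  obtain D :: "'a set" where D: "countable D" "closure D = UNIV" using sep by blast
  define P where "P = {(d, m :: nat). d \<in> D \<and> (\<exists>s\<in>S. dist s d < 1 / real (Suc m))}"
  have "\<forall>p\<in>P. \<exists>s\<in>S. dist s (fst p) < 1 / real (Suc (snd p))" unfolding P_def by auto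
  then obtain c where c: "\<And>p. p \<in> P \<Longrightarrow> c p \<in> S \<and> dist (c p) (fst p) < 1 / real (Suc (snd p))" by metis
  have "countable P" using D(1) by (intro countable_subset[of P "D \<times> UNIV"]) (auto simp: P_def)
  moreover have "s \<in> closure (c ` P)" if s: "s \<in> S" for s
    unfolding closure_approachable
  proof (intro allI impI)
    fix e :: real assume "0 < e"
    then obtain m where m: "1 / real (Suc m) < e / 2"
      using reals_Archimedean[of "e / 2"] by (auto simp: inverse_eq_divide)
    have "s \<in> closure D" using D by simp
    then obtain d where d: "d \<in> D" "dist d s < 1 / real (Suc m)"
      unfolding closure_approachable by (metis of_nat_0_less_iff zero_less_Suc zero_less_divide_1_iff)
    then have p: "(d, m) \<in> P" using s unfolding P_def by (auto simp: dist_commute)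
    have "dist (c (d, m)) s \<le> dist (c (d, m)) d + dist d s" by (rule dist_triangle)
    then have "dist (c (d, m)) s < e" using c[OF p] d(2) m by simp
    then show "\<exists>y\<in>c ` P. dist y s < e" using p by blast
  qed
  ultimately show ?thesis using c by (intro exI[of _ "c ` P"]) auto
qed

text \<open>Pettis: norms, hence closed balls, are determined by countably many functionals.\<close>
lemma borel_measurable_weakI:
  fixes X :: "'w \<Rightarrow> 'a::real_inner"
  assumes sep: "\<exists>D::'a set. countable D \<and> closure D = UNIV"
    and meas: "\<And>y. (\<lambda>\<omega>. inner (X \<omega>) y) \<in> borel_measurable M"
  shows "X \<in> borel_measurable M"
proof (rule borel_measurableI)
  obtain D :: "'a set" where D: "countable D" "closure D = UNIV" using sep by blast
  have ball: "dist c x \<le> r \<longleftrightarrow> (\<forall>d\<in>D. inner x d - inner c d \<le> r * norm d)" if "0 < r" for c x r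
  proof
    assume "dist c x \<le> r"
    then have "norm (x - c) \<le> r" by (simp add: dist_norm norm_minus_commute)
    then have "inner (x - c) d \<le> r * norm d" for d
      using norm_cauchy_schwarz[of "x - c" d] mult_right_mono[of "norm (x - c)" r "norm d"] by simp
    then show "\<forall>d\<in>D. inner x d - inner c d \<le> r * norm d" by (simp add: inner_diff)
  next
    assume le: "\<forall>d\<in>D. inner x d - inner c d \<le> r * norm d"
    \<comment> \<open>The condition is closed in \<open>d\<close>, so it passes from
      \<open>D\<close> to all vectors; at \<open>x - c\<close> it becomes the norm bound.\<close>
    have "closed {d. inner x d - inner c d \<le> r * norm d}"
      by (intro closed_Collect_le continuous_intros)
    then have "closure D \<subseteq> {d. inner x d - inner c d \<le> r * norm d}"
      using le by (intro closure_minimal) auto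
    then have "inner x (x - c) - inner c (x - c) \<le> r * norm (x - c)" using D by auto
    then have "norm (x - c) * norm (x - c) \<le> r * norm (x - c)"
      by (simp add: inner_diff_left power2_norm_eq_inner flip: power2_eq_square)
    then show "dist c x \<le> r"
      using that by (cases "norm (x - c) = 0") (auto simp: dist_norm norm_minus_commute)
  qed
  fix S :: "'a set" assume S: "open S"
  define P where "P = {(c, m :: nat). c \<in> D \<and> cball c (1 / real (Suc m)) \<subseteq> S}"
  have "countable P" using D(1) by (intro countable_subset[of P "D \<times> UNIV"]) (auto simp: P_def)
  \<comment> \<open>Closed balls with centres in \<open>D\<close> and radii 1/(m+1) reduce an open
    set to countably many conditions.\<close>
  have cov: "S = (\<Union>p\<in>P. cball (fst p) (1 / real (Suc (snd p))))"
  proof (intro subset_antisym subsetI)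
    fix x assume "x \<in> S"
    then obtain e where e: "0 < e" "ball x e \<subseteq> S" using S openE by blast
    obtain m where m: "1 / real (Suc m) < e / 2"
      using reals_Archimedean[of "e / 2"] e by (auto simp: inverse_eq_divide)
    have "x \<in> closure D" using D by simp
    then obtain d where d: "d \<in> D" "dist d x < 1 / real (Suc m)"
      unfolding closure_approachable by (metis of_nat_0_less_iff zero_less_Suc zero_less_divide_1_iff)
    have "cball d (1 / real (Suc m)) \<subseteq> ball x e"
    proof
      fix y assume "y \<in> cball d (1 / real (Suc m))"
      then show "y \<in> ball x e" using dist_triangle[of x y d] d(2) m by (simp add: dist_commute)
    qed
    then have "(d, m) \<in> P" using d e unfolding P_def by auto
    then show "x \<in> (\<Union>p\<in>P. cball (fst p) (1 / real (Suc (snd p))))"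
      using d(2) by (intro UN_I[of "(d, m)"]) auto
  qed (auto simp: P_def)
  have "X -` cball c (1 / real (Suc m)) \<inter> space M \<in> sets M" for c m
  proof -
    have "X -` cball c (1 / real (Suc m)) \<inter> space M =
        {\<omega> \<in> space M. \<forall>d\<in>D. inner (X \<omega>) d - inner c d \<le> 1 / real (Suc m) * norm d}"
      using ball[of "1 / real (Suc m)" c] by (auto simp del: of_nat_Suc)
    also have "\<dots> \<in> sets M"
    proof (cases "D = {}")
      case False
      then obtain f :: "nat \<Rightarrow> 'a" where f: "D = range f" using uncountable_def[of D] D(1) by blast
      have "(\<lambda>\<omega>. inner (X \<omega>) (f j) - inner c (f j)) \<in> borel_measurable M" for j
        by (intro borel_measurable_diff meas) simp
      then have "{\<omega> \<in> space M. \<forall>j. inner (X \<omega>) (f j) - inner c (f j) \<le> 1 / real (Suc m) * norm (f j)} \<in> sets M"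
        by (intro sets.sets_Collect_countable_All borel_measurable_le) simp_all
      then show ?thesis unfolding f by simp
    qed auto
    finally show ?thesis .
  qed
  then have "(\<Union>p\<in>P. X -` cball (fst p) (1 / real (Suc (snd p))) \<inter> space M) \<in> sets M"
    using \<open>countable P\<close> by (intro sets.countable_UN') auto
  moreover have "X -` S \<inter> space M = (\<Union>p\<in>P. X -` cball (fst p) (1 / real (Suc (snd p))) \<inter> space M)"
    unfolding cov by auto
  ultimately show "X -` S \<inter> space M \<in> sets M" by simp
qed

section \<open>The Lyapunov function and convergence of the iterates\<close>

locale stochastic_frb = uniform_indices M I n
  for M :: "'w measure" and I :: "nat \<Rightarrow> 'w \<Rightarrow> nat" and n :: nat +
  fixes A :: "'a::{real_inner, complete_space} \<Rightarrow> 'a set"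
    and B :: "'a \<Rightarrow> 'a" and Bi :: "nat \<Rightarrow> 'a \<Rightarrow> 'a"
    and L lam :: real and x0 xm1 :: 'a
  assumes maxmon: "maximal_monotone A" and Bmon: "monotone_map B"
    and B_avg: "\<And>x. B x = (1 / real n) *\<^sub>R (\<Sum>i=1..n. Bi i x)"
    and Bi_lip: "\<And>i. i \<in> {1..n} \<Longrightarrow> L-lipschitz_on UNIV (Bi i)"
    and lam_pos: "0 < lam" and lam_small: "lam * (2 * L) < 1"
begin

lemma L_nonneg: "0 \<le> L"
  using lipschitz_on_nonneg[OF Bi_lip[of 1]] n_pos by simp

lemma B_lip: "L-lipschitz_on UNIV B"
proof -
  have B_eq: "B = (\<lambda>x. (1 / real n) *\<^sub>R (\<Sum>i=1..n. Bi i x))" by (rule ext) (rule B_avg)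
  show ?thesis unfolding B_eq by (rule lipschitz_on_average[OF n_pos Bi_lip])
qed

text \<open>The iteration driven by a finite word; the unspecified values of \<open>w ! j\<close>
  beyond its length are never read.\<close>

definition state :: "nat list \<Rightarrow> 'a \<times> 'a" where
  "state w = fbf_iter (resolvent lam A) B Bi lam x0 xm1 (\<lambda>j. w ! j) (length w)"

definition cur :: "nat list \<Rightarrow> 'a" where "cur w = fst (state w)"

definition prev :: "nat list \<Rightarrow> 'a" where "prev w = snd (state w)"

lemma state_snoc:
  "cur (w @ [i]) = resolvent lam A
     (cur w - lam *\<^sub>R B (cur w) - lam *\<^sub>R (Bi i (cur w) - Bi i (prev w)))"
  "prev (w @ [i]) = cur w"
proof -
  have "fbf_iter (resolvent lam A) B Bi lam x0 xm1 (\<lambda>j. (w @ [i]) ! j) (length w) = state w"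
    unfolding state_def by (rule fbf_iter_cong) (simp add: nth_append)
  then show "cur (w @ [i]) = resolvent lam A
     (cur w - lam *\<^sub>R B (cur w) - lam *\<^sub>R (Bi i (cur w) - Bi i (prev w)))"
    and "prev (w @ [i]) = cur w"
    unfolding cur_def prev_def state_def[of "w @ [i]"] by (simp_all add: Let_def case_prod_beta)
qed

lemma fbf_iter_hist:
  "fst (fbf_iter (resolvent lam A) B Bi lam x0 xm1 (\<lambda>j. I j \<omega>) k) = cur (hist k \<omega>)"
proof -
  have "fbf_iter (resolvent lam A) B Bi lam x0 xm1 (\<lambda>j. I j \<omega>) k = state (hist k \<omega>)"
    unfolding state_def length_hist by (rule fbf_iter_cong) (simp add: hist_def)
  then show ?thesis unfolding cur_def by simp
qed

definition lyapunov :: "'a \<Rightarrow> nat list \<Rightarrow> real" where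
  "lyapunov z w = (norm (cur w - z))\<^sup>2 - 2 * lam * inner (cur w - z) (B (cur w) - B (prev w))
     + 1 / 2 * (norm (cur w - prev w))\<^sup>2"

text \<open>The cross term costs at most lam L <= 1/2 of each square: half of the distance term
  survives, and the last summand pays for the rest.\<close>

lemma lyapunov_ge: "1 / 2 * (norm (cur w - z))\<^sup>2 \<le> lyapunov z w"
proof -
  have "norm (B (cur w) - B (prev w)) \<le> L * norm (cur w - prev w)"
    using lipschitz_onD[OF B_lip, of "cur w" "prev w"] by (simp add: dist_norm)
  then have "2 * \<bar>inner (cur w - z) (B (cur w) - B (prev w))\<bar>
      \<le> L * ((norm (cur w - z))\<^sup>2 + (norm (cur w - prev w))\<^sup>2)"
    by (rule inner_le_half_sum_squares[OF _ L_nonneg])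
  then have "2 * inner (cur w - z) (B (cur w) - B (prev w))
      \<le> L * ((norm (cur w - z))\<^sup>2 + (norm (cur w - prev w))\<^sup>2)" by linarith
  from mult_left_mono[OF this, of lam]
  have "2 * lam * inner (cur w - z) (B (cur w) - B (prev w))
      \<le> (lam * L) * ((norm (cur w - z))\<^sup>2 + (norm (cur w - prev w))\<^sup>2)"
    using lam_pos by (simp add: algebra_simps)
  also have "\<dots> \<le> 1 / 2 * ((norm (cur w - z))\<^sup>2 + (norm (cur w - prev w))\<^sup>2)"
    using lam_small by (intro mult_right_mono) auto
  finally show ?thesis unfolding lyapunov_def by (simp add: algebra_simps)
qed

lemma lyapunov_supermartingale:
  assumes z: "z \<in> zeros_sum A B"
  shows "(\<Sum>i=1..n. lyapunov z (w @ [i])) / real n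
    \<le> lyapunov z w - (1 / 2 - lam * L) * (norm (cur w - prev w))\<^sup>2"
proof -
  let ?d = "\<lambda>i. Bi i (cur w) - Bi i (prev w)"
  define c where "c = (norm (cur w - z))\<^sup>2 + lam * L * (norm (cur w - prev w))\<^sup>2"
  have step: "lyapunov z (w @ [i]) \<le> c - 2 * lam * inner (cur w - z) (?d i)" if i: "i \<in> {1..n}" for i
  proof -
    have "norm (?d i) \<le> L * norm (cur w - prev w)"
      using lipschitz_onD[OF Bi_lip[OF i], of "cur w" "prev w"] by (simp add: dist_norm)
    from forward_reflected_backward_step[OF maxmon lam_pos Bmon z L_nonneg this state_snoc(1)]
    have le: "(norm (cur (w @ [i]) - z))\<^sup>2
        - 2 * lam * inner (cur (w @ [i]) - z) (B (cur (w @ [i])) - B (cur w))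
        + (1 - lam * L) * (norm (cur (w @ [i]) - cur w))\<^sup>2 \<le> c - 2 * lam * inner (cur w - z) (?d i)"
      unfolding c_def by simp
    have "1 / 2 * (norm (cur (w @ [i]) - cur w))\<^sup>2 \<le> (1 - lam * L) * (norm (cur (w @ [i]) - cur w))\<^sup>2"
      using lam_small by (intro mult_right_mono) auto
    with le show ?thesis unfolding lyapunov_def state_snoc(2) by linarith
  qed
  \<comment> \<open>Unbiasedness: the sampled differences average to the difference of
    \<open>B\<close>, which is the cross term of \<open>lyapunov z w\<close>.\<close>
  have avg: "(\<Sum>i=1..n. inner (cur w - z) (?d i)) = real n * inner (cur w - z) (B (cur w) - B (prev w))"
    using n_pos by (simp add: B_avg inner_sum_right[symmetric] sum_subtractf scaleR_diff_right[symmetric])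
  have "(\<Sum>i=1..n. lyapunov z (w @ [i])) \<le> (\<Sum>i=1..n. c - 2 * lam * inner (cur w - z) (?d i))"
    by (intro sum_mono step)
  also have "\<dots> = real n * c - 2 * lam * (\<Sum>i=1..n. inner (cur w - z) (?d i))"
    by (simp add: sum_subtractf sum_distrib_left)
  also have "\<dots> = real n * (c - 2 * lam * inner (cur w - z) (B (cur w) - B (prev w)))"
    unfolding avg by (simp add: algebra_simps)
  \<comment> \<open>Here lam L is read as 1/2 - (1/2 - lam L).\<close>
  also have "\<dots> = real n * (lyapunov z w - (1 / 2 - lam * L) * (norm (cur w - prev w))\<^sup>2)"
    unfolding c_def lyapunov_def by (simp add: algebra_simps)
  finally show ?thesis using n_pos by (simp add: pos_divide_le_eq mult.commute)
qed

text \<open>Solve the definition of \<open>lyapunov\<close> for the squared distance. The distance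
  is bounded by \<open>lyapunov_ge\<close>, so the cross term is a bounded factor times a null
  sequence.\<close>

lemma lyapunov_convergent_imp:
  assumes conv: "convergent (\<lambda>k. lyapunov z (h k))" and diff: "(\<lambda>k. cur (h k) - prev (h k)) \<longlonglongrightarrow> 0"
  shows "convergent (\<lambda>k. norm (cur (h k) - z))"
proof -
  obtain l where l: "(\<lambda>k. lyapunov z (h k)) \<longlonglongrightarrow> l" using conv convergent_def by blast
  obtain C where C: "\<And>k. norm (lyapunov z (h k)) \<le> C"
    using convergent_imp_Bseq[OF conv] unfolding Bseq_def by blast
  have bdd: "norm (cur (h k) - z) \<le> sqrt (2 * C)" for k
  proof (rule real_le_rsqrt)
    show "(norm (cur (h k) - z))\<^sup>2 \<le> 2 * C" using lyapunov_ge[of "h k" z] C[of k] by simp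
  qed
  have Bd: "(\<lambda>k. B (cur (h k)) - B (prev (h k))) \<longlonglongrightarrow> 0"
  proof (rule Lim_null_comparison)
    show "\<forall>\<^sub>F k in sequentially. norm (B (cur (h k)) - B (prev (h k))) \<le> L * norm (cur (h k) - prev (h k))"
      using lipschitz_onD[OF B_lip] by (simp add: dist_norm)
    show "(\<lambda>k. L * norm (cur (h k) - prev (h k))) \<longlonglongrightarrow> 0"
      using tendsto_mult[OF tendsto_const[of L] tendsto_norm[OF diff]] by simp
  qed
  have in0: "(\<lambda>k. inner (cur (h k) - z) (B (cur (h k)) - B (prev (h k)))) \<longlonglongrightarrow> 0"
  proof (rule Lim_null_comparison)
    show "\<forall>\<^sub>F k in sequentially. norm (inner (cur (h k) - z) (B (cur (h k)) - B (prev (h k))))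
        \<le> sqrt (2 * C) * norm (B (cur (h k)) - B (prev (h k)))"
      using order_trans[OF Cauchy_Schwarz_ineq2 mult_right_mono[OF bdd norm_ge_zero]] by simp
    show "(\<lambda>k. sqrt (2 * C) * norm (B (cur (h k)) - B (prev (h k)))) \<longlonglongrightarrow> 0"
      using tendsto_mult[OF tendsto_const[of "sqrt (2 * C)"] tendsto_norm[OF Bd]] by simp
  qed
  have "(\<lambda>k. sqrt (lyapunov z (h k) + 2 * lam * inner (cur (h k) - z) (B (cur (h k)) - B (prev (h k)))
      - 1 / 2 * (norm (cur (h k) - prev (h k)))\<^sup>2)) \<longlonglongrightarrow> sqrt (l + 2 * lam * 0 - 1 / 2 * (norm (0 :: 'a))\<^sup>2)"
    by (intro tendsto_intros l in0 diff)
  then show ?thesis unfolding lyapunov_def convergent_def by auto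
qed

text \<open>One \<open>z\<close> at a time, because the null set comes from the supermartingale
  belonging to that \<open>z\<close>.\<close>

lemma AE_iterates_quasi_fejer:
  assumes z: "z \<in> zeros_sum A B"
  shows "AE \<omega> in M. convergent (\<lambda>k. norm (cur (hist k \<omega>) - z)) \<and>
    (\<lambda>k. cur (hist k \<omega>) - prev (hist k \<omega>)) \<longlonglongrightarrow> 0"
proof -
  have pos: "0 < 1 / 2 - lam * L" using lam_small by simp
  have "AE \<omega> in M. convergent (\<lambda>k. lyapunov z (hist k \<omega>)) \<and>
      summable (\<lambda>k. (1 / 2 - lam * L) * (norm (cur (hist k \<omega>) - prev (hist k \<omega>)))\<^sup>2)"
  proof (rule AE_supermartingale_decrease_summable)
    fix w
    show "0 \<le> lyapunov z w" using lyapunov_ge[of w z] zero_le_power2[of "norm (cur w - z)"] by linarith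
    show "0 \<le> (1 / 2 - lam * L) * (norm (cur w - prev w))\<^sup>2" using pos by simp
  qed (rule lyapunov_supermartingale[OF z])
  then show ?thesis
  proof eventually_elim
    case (elim \<omega>)
    have "summable (\<lambda>k. (norm (cur (hist k \<omega>) - prev (hist k \<omega>)))\<^sup>2)"
      using elim pos summable_cmult_iff[of "1 / 2 - lam * L"] by auto
    from tendsto_real_sqrt[OF summable_LIMSEQ_zero[OF this]]
    have diff: "(\<lambda>k. cur (hist k \<omega>) - prev (hist k \<omega>)) \<longlonglongrightarrow> 0"
      by (simp add: tendsto_norm_zero_iff)
    then show ?case using lyapunov_convergent_imp[of z "\<lambda>k. hist k \<omega>"] elim by simp
  qed
qed

text \<open>Demiclosedness of A + B: testing monotonicity against any pair in the graph of A, the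
  points converge weakly and the residuals strongly, so the pairing passes to the limit.\<close>

lemma weak_cluster_point_zero:
  fixes y u :: "nat \<Rightarrow> 'a"
  assumes u: "\<And>k. u k \<in> A (y k)" and res: "(\<lambda>k. u k + B (y k)) \<longlonglongrightarrow> 0"
    and weak: "weakly_tendsto y p" and bdd: "\<And>k. norm (y k) \<le> K"
  shows "p \<in> zeros_sum A B"
proof (rule zeros_sum_variationalI[OF maxmon B_lip])
  fix a b assume ab: "b \<in> A a"
  have "(\<lambda>k. inner (y k - a) (u k + B (y k) - (b + B a))) \<longlonglongrightarrow> inner (p - a) (0 - (b + B a))"
  proof (rule bounded_weak_strong_inner)
    show "weakly_tendsto (\<lambda>k. y k - a) (p - a)"
      unfolding weakly_tendsto_def inner_diff_left
    proof
      fix d show "(\<lambda>k. inner (y k) d - inner a d) \<longlonglongrightarrow> inner p d - inner a d"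
        using weak unfolding weakly_tendsto_def by (intro tendsto_diff tendsto_const) blast
    qed
    show "(\<lambda>k. u k + B (y k) - (b + B a)) \<longlonglongrightarrow> 0 - (b + B a)" by (intro tendsto_diff res tendsto_const)
    show "norm (y k - a) \<le> K + norm a" for k using norm_triangle_ineq4[of "y k" a] bdd[of k] by linarith
  qed
  moreover have "0 \<le> inner (y k - a) (u k + B (y k) - (b + B a))" for k
  proof -
    have "0 \<le> inner (y k - a) (u k - b) + inner (y k - a) (B (y k) - B a)"
      using maximal_monotoneD[OF maxmon u ab, of k] Bmon unfolding monotone_map_def
      by (intro add_nonneg_nonneg) auto
    then show ?thesis by (simp add: inner_diff inner_add)
  qed
  ultimately have "0 \<le> inner (p - a) (0 - (b + B a))" by (intro LIMSEQ_le_const) auto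
  then show "0 \<le> inner (p - a) (- b - B a)" by simp
qed

lemma iterates_weakly_convergent:
  assumes sep: "\<exists>D::'a set. countable D \<and> closure D = UNIV" and ne: "zeros_sum A B \<noteq> {}"
    and idx: "\<And>k. I k \<omega> \<in> {1..n}"
    and conv: "\<And>z. z \<in> zeros_sum A B \<Longrightarrow> convergent (\<lambda>k. norm (cur (hist k \<omega>) - z))"
    and diff: "(\<lambda>k. cur (hist k \<omega>) - prev (hist k \<omega>)) \<longlonglongrightarrow> 0"
  shows "\<exists>p\<in>zeros_sum A B. weakly_tendsto (\<lambda>k. cur (hist k \<omega>)) p"
proof -
  define x where "x k = cur (hist k \<omega>)" for k
  define y where "y k = prev (hist k \<omega>)" for k
  have xy: "(\<lambda>k. x k - y k) \<longlonglongrightarrow> 0" using diff unfolding x_def y_def .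
  have ySuc: "y (Suc k) = x k" for k unfolding x_def y_def hist_Suc state_snoc ..
  have dx: "(\<lambda>k. x (Suc k) - x k) \<longlonglongrightarrow> 0" using LIMSEQ_Suc[OF xy] unfolding ySuc .
  obtain z where z: "z \<in> zeros_sum A B" using ne by blast
  obtain K where K: "\<And>k. norm (norm (x k - z)) \<le> K"
    using convergent_imp_Bseq[OF conv[OF z]] unfolding Bseq_def x_def by blast
  have bdd: "norm (x k) \<le> K + norm z" for k
    using K[of k] norm_triangle_sub[of "x k" z] by simp
  define d where "d k = Bi (I k \<omega>) (x k) - Bi (I k \<omega>) (y k)" for k
  have xSuc: "x (Suc k) = resolvent lam A (x k - lam *\<^sub>R B (x k) - lam *\<^sub>R d k)" for k
    unfolding x_def y_def d_def hist_Suc state_snoc ..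
  have "\<exists>u\<in>A (x (Suc k)). x k - lam *\<^sub>R B (x k) - lam *\<^sub>R d k = x (Suc k) + lam *\<^sub>R u" for k
    unfolding xSuc by (rule resolvent_inclusion[OF maxmon lam_pos])
  then obtain u where u: "\<And>k. u k \<in> A (x (Suc k))"
    "\<And>k. x k - lam *\<^sub>R B (x k) - lam *\<^sub>R d k = x (Suc k) + lam *\<^sub>R u k" by metis
  have d0: "d \<longlonglongrightarrow> 0"
  proof (rule Lim_null_comparison)
    show "\<forall>\<^sub>F k in sequentially. norm (d k) \<le> L * norm (x k - y k)"
      unfolding d_def using lipschitz_onD[OF Bi_lip[OF idx]] by (simp add: dist_norm)
    show "(\<lambda>k. L * norm (x k - y k)) \<longlonglongrightarrow> 0"
      using tendsto_mult[OF tendsto_const[of L] tendsto_norm[OF xy]] by simp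
  qed
  have B0: "(\<lambda>k. B (x (Suc k)) - B (x k)) \<longlonglongrightarrow> 0"
  proof (rule Lim_null_comparison)
    show "\<forall>\<^sub>F k in sequentially. norm (B (x (Suc k)) - B (x k)) \<le> L * norm (x (Suc k) - x k)"
      using lipschitz_onD[OF B_lip] by (simp add: dist_norm)
    show "(\<lambda>k. L * norm (x (Suc k) - x k)) \<longlonglongrightarrow> 0"
      using tendsto_mult[OF tendsto_const[of L] tendsto_norm[OF dx]] by simp
  qed
  \<comment> \<open>The resolvent inclusion solved for the residual of A + B at x_{k+1}; each of the
    three terms on the right tends to 0.\<close>
  have res_eq: "u k + B (x (Suc k)) = (B (x (Suc k)) - B (x k)) - d k - (1 / lam) *\<^sub>R (x (Suc k) - x k)" for k
  proof -
    have "lam *\<^sub>R u k = x k - lam *\<^sub>R B (x k) - lam *\<^sub>R d k - x (Suc k)" using u(2)[of k] by simp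
    then have "(1 / lam) *\<^sub>R (lam *\<^sub>R u k) = (1 / lam) *\<^sub>R (x k - lam *\<^sub>R B (x k) - lam *\<^sub>R d k - x (Suc k))" by simp
    then show ?thesis using lam_pos by (simp add: scaleR_diff_right)
  qed
  have "(\<lambda>k. u k + B (x (Suc k))) \<longlonglongrightarrow> 0 - 0 - (1 / lam) *\<^sub>R 0"
    unfolding res_eq by (intro tendsto_diff tendsto_scaleR tendsto_const B0 d0 dx)
  then have res: "(\<lambda>k. u k + B (x (Suc k))) \<longlonglongrightarrow> 0" by simp
  have "\<exists>p\<in>zeros_sum A B. weakly_tendsto x p"
  proof (rule opial[OF sep ne])
    show "convergent (\<lambda>k. norm (x k - z))" if "z \<in> zeros_sum A B" for z
      using conv[OF that] unfolding x_def .
    fix r :: "nat \<Rightarrow> nat" and p assume r: "strict_mono r" "weakly_tendsto (x \<circ> r) p"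
    show "p \<in> zeros_sum A B"
    proof (rule weak_cluster_point_zero)
      show "u (r k) \<in> A (x (Suc (r k)))" for k by (rule u)
      show "(\<lambda>k. u (r k) + B (x (Suc (r k)))) \<longlonglongrightarrow> 0"
        using LIMSEQ_subseq_LIMSEQ[OF res r(1)] by (simp add: o_def)
      show "weakly_tendsto (\<lambda>k. x (Suc (r k))) p"
        using LIMSEQ_subseq_LIMSEQ[OF dx r(1)] by (intro weakly_tendsto_perturb[OF r(2)]) (simp add: o_def)
    qed (rule bdd)
  qed
  then show ?thesis unfolding x_def .
qed

lemma AE_weakly_convergent:
  assumes sep: "\<exists>D::'a set. countable D \<and> closure D = UNIV" and ne: "zeros_sum A B \<noteq> {}"
  shows "AE \<omega> in M. \<exists>p\<in>zeros_sum A B. weakly_tendsto (\<lambda>k. cur (hist k \<omega>)) p"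
proof -
  obtain Q where Q: "countable Q" "Q \<subseteq> zeros_sum A B" "zeros_sum A B \<subseteq> closure Q"
    using countable_dense_subset[OF sep] by blast
  \<comment> \<open>The limit of the differences is stated under a quantifier over \<open>Q\<close>,
    so an element of \<open>Q\<close> is needed to extract it.\<close>
  have "Q \<noteq> {}" using Q ne by auto
  have "AE \<omega> in M. \<forall>q\<in>Q. convergent (\<lambda>k. norm (cur (hist k \<omega>) - q)) \<and>
      (\<lambda>k. cur (hist k \<omega>) - prev (hist k \<omega>)) \<longlonglongrightarrow> 0"
    unfolding AE_ball_countable[OF Q(1)] using AE_iterates_quasi_fejer Q(2) by blast
  then show ?thesis
    using AE_indices
  proof eventually_elim
    case (elim \<omega>)
    show ?case
    proof (rule iterates_weakly_convergent[OF sep ne])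
      fix z assume "z \<in> zeros_sum A B"
      then have z: "z \<in> closure Q" using Q by blast
      show "convergent (\<lambda>k. norm (cur (hist k \<omega>) - z))"
      \<comment> \<open>Replacing \<open>z\<close> by \<open>q\<close> changes every distance by at
        most \<open>dist q z\<close>, uniformly in \<open>k\<close>.\<close>
      proof (rule convergent_uniform_approx)
        fix e :: real assume "0 < e"
        then obtain q where q: "q \<in> Q" "dist q z < e" using z closure_approachable by blast
        have "dist (norm (cur (hist k \<omega>) - z)) (norm (cur (hist k \<omega>) - q)) \<le> e" for k
          using norm_triangle_ineq3[of "cur (hist k \<omega>) - z" "cur (hist k \<omega>) - q"] q(2)
          by (simp add: dist_norm)
        then show "\<exists>c. convergent c \<and> (\<forall>k. dist (norm (cur (hist k \<omega>) - z)) (c k) \<le> e)"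
          using elim(1) q(1) by blast
      qed
    qed (use elim \<open>Q \<noteq> {}\<close> in auto)
  qed
qed

text \<open>On a measurable null set \<open>N\<close> that covers the exceptional points, the limit
  is replaced by a fixed zero, so that values are zeros everywhere. The choice by
  \<open>SOME\<close> is harmless for measurability: each scalar product of the limit is a pointwise
  limit of measurable functions, and this suffices by \<open>borel_measurable_weakI\<close>.\<close>

lemma weak_limit_random_variable:
  assumes sep: "\<exists>D::'a set. countable D \<and> closure D = UNIV" and ne: "zeros_sum A B \<noteq> {}"
  shows "\<exists>X :: 'w \<Rightarrow> 'a. X \<in> borel_measurable M \<and> (\<forall>\<omega> \<in> space M. X \<omega> \<in> zeros_sum A B) \<and>
    (AE \<omega> in M. weakly_tendsto (\<lambda>k. cur (hist k \<omega>)) (X \<omega>))"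
proof -
  obtain z where z: "z \<in> zeros_sum A B" using ne by blast
  obtain N where N: "{\<omega>\<in>space M. \<not> (\<exists>p\<in>zeros_sum A B. weakly_tendsto (\<lambda>k. cur (hist k \<omega>)) p)} \<subseteq> N"
    "emeasure M N = 0" "N \<in> sets M"
    using AE_E[OF AE_weakly_convergent[OF sep ne]] .
  define X where "X \<omega> = (if \<omega> \<in> N then z else
    (SOME p. p \<in> zeros_sum A B \<and> weakly_tendsto (\<lambda>k. cur (hist k \<omega>)) p))" for \<omega>
  have X: "X \<omega> \<in> zeros_sum A B \<and> weakly_tendsto (\<lambda>k. cur (hist k \<omega>)) (X \<omega>)" if "\<omega> \<in> space M - N" for \<omega>
  proof -
    have "\<exists>p. p \<in> zeros_sum A B \<and> weakly_tendsto (\<lambda>k. cur (hist k \<omega>)) p" using N(1) that by blast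
    from someI_ex[OF this] show ?thesis using that unfolding X_def by simp
  qed
  have "X \<in> borel_measurable M"
  proof (rule borel_measurable_weakI[OF sep])
    fix y
    show "(\<lambda>\<omega>. inner (X \<omega>) y) \<in> borel_measurable M"
    proof (rule borel_measurable_LIMSEQ_real)
      fix \<omega> assume "\<omega> \<in> space M"
      then show "(\<lambda>k. if \<omega> \<in> N then inner z y else inner (cur (hist k \<omega>)) y) \<longlonglongrightarrow> inner (X \<omega>) y"
        using X[of \<omega>] unfolding weakly_tendsto_def by (auto simp: X_def)
    next
      fix k
      have [measurable]: "(\<lambda>\<omega>. inner (cur (hist k \<omega>)) y) \<in> borel_measurable M"
        by (rule borel_measurable_hist)
      note N(3) [measurable]
      show "(\<lambda>\<omega>. if \<omega> \<in> N then inner z y else inner (cur (hist k \<omega>)) y) \<in> borel_measurable M"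
        by measurable
    qed
  qed
  moreover have "\<forall>\<omega>\<in>space M. X \<omega> \<in> zeros_sum A B" using X z by (auto simp: X_def)
  moreover have "AE \<omega> in M. weakly_tendsto (\<lambda>k. cur (hist k \<omega>)) (X \<omega>)"
    using N X by (intro AE_I[of _ _ N]) auto
  ultimately show ?thesis by blast
qed

end

theorem theorem6p2:
  fixes A :: "'a::{real_inner, complete_space} \<Rightarrow> 'a set"
    and B :: "'a \<Rightarrow> 'a"
    and Bi :: "nat \<Rightarrow> 'a \<Rightarrow> 'a"
    and n :: nat and L lam :: real
    and x0 xm1 :: 'a
    and M :: "'w measure"
    and I :: "nat \<Rightarrow> 'w \<Rightarrow> nat"
  assumes separable: "\<exists>D::'a set. countable D \<and> closure D = UNIV"
    and maxmon: "maximal_monotone A"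
    and Bmon: "monotone_map B"
    and n_pos: "n \<ge> 1"
    and B_avg: "\<And>x. B x = (1 / real n) *\<^sub>R (\<Sum>i=1..n. Bi i x)"
    and Bi_lip: "\<And>i. i \<in> {1..n} \<Longrightarrow> L-lipschitz_on UNIV (Bi i)"
    and zeros_ne: "zeros_sum A B \<noteq> {}"
    and lam_pos: "0 < lam"
    and lam_small: "lam * (2 * L) < 1"
    and prob: "prob_space M"
    and indep: "prob_space.indep_vars M (\<lambda>_. count_space UNIV) I UNIV"
    and unif: "\<And>k. distr M (count_space UNIV) (I k) = measure_pmf (pmf_of_set {1..n})"
  shows "\<exists>X :: 'w \<Rightarrow> 'a. X \<in> borel_measurable M
           \<and> (\<forall>\<omega> \<in> space M. X \<omega> \<in> zeros_sum A B)
           \<and> (AE \<omega> in M. weakly_tendsto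
                 (\<lambda>k. fst (fbf_iter (resolvent lam A) B Bi lam x0 xm1 (\<lambda>j. I j \<omega>) k))
                 (X \<omega>))"
proof -
  interpret prob_space M by (rule prob)
  interpret stochastic_frb M I n A B Bi L lam x0 xm1
    by unfold_locales (fact n_pos indep unif maxmon Bmon B_avg Bi_lip lam_pos lam_small)+
  show ?thesis
    unfolding fbf_iter_hist by (rule weak_limit_random_variable[OF separable zeros_ne])
qed

end
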